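(* Let $(T,\omega)$ and $(T',\omega')$ be strictly weighted $2$-stars such that $D_{(T,\mathsf m_\omega)}(\mathbf z)=D_{(T',\mathsf m_{\omega'})}(\mathbf z)$. Then $(T,\omega)$ and $(T',\omega')$ are $\omega$-isomorphic. (That is, a strictly weighted $2$-star can be reconstructed from its $D$-polynomial.)
   Context: A $2$-star is a tree obtained by taking two disjoint stars and joining their centers by an edge. A weighted tree $(T,\omega)$ has $\omega:V(T)\to\{1,2,\dots\}$; it is strictly weighted if all weights exceed $1$. $\omega$-isomorphic means isomorphic via a weight-preserving graph isomorphism. The marked version gives vertex $v$ the mark $(\omega(v),0)$; marks are pairs $(w,d)$ with $w\ge1,d\ge0,w\ge d+1$ and dot-sum $(w,d)\dotplus(w',d')=(w+w',d+d'+1)$. For a marked tree, $M_{(T,\mathsf m)}(\mathbf z)=\sum_{A\subseteq E(T)}\prod_C z_{\mathsf m(C)}$ over the connected components $C$ of $(V(T),A)$, with $\mathsf m(C)$ the dot-sum of the marks of the vertices of $C$ and $z_{w,d}$ commuting indeterminates. With $D_{\bullet_{w,d}}=\sum_{i=0}^d(-1)^i\binom di z_{w-i,0}z_{1,0}^i$, $D_{(T,\mathsf m)}(\mathbf z)$ is $M_{(T,\mathsf m)}$ with each $z_{w,d}$ replaced by $D_{\bullet_{w,d}}$. *)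

theory Defs
  imports Main "HOL-Library.Poly_Mapping"
begin

text \<open>
  A finite simple graph is a pair of a vertex set \<open>V\<close> and a set \<open>E\<close> of two-element subsets of \<open>V\<close>.
\<close>

definition components :: "'a set \<Rightarrow> 'a set set \<Rightarrow> 'a set set" where
  "components V A = V // {(u, v). u \<in> V \<and> v \<in> V \<and> (u, v) \<in> {(x, y). {x, y} \<in> A}\<^sup>*}"

text \<open>
  A star has any number \<open>k \<ge> 0\<close> of leaves; the one-vertex star is allowed.
  For a star with one leaf either vertex may serve as the center.
\<close>

definition star_with_center :: "'a set \<Rightarrow> 'a set set \<Rightarrow> 'a \<Rightarrow> bool" where
  "star_with_center V E c \<longleftrightarrow> finite V \<and> c \<in> V \<and> E = {{c, v} | v. v \<in> V - {c}}"

definition two_star :: "'a set \<Rightarrow> 'a set set \<Rightarrow> bool" where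
  "two_star V E \<longleftrightarrow>
     (\<exists>V1 E1 c1 V2 E2 c2.
        star_with_center V1 E1 c1 \<and> star_with_center V2 E2 c2 \<and> V1 \<inter> V2 = {} \<and>
        V = V1 \<union> V2 \<and> E = E1 \<union> E2 \<union> {{c1, c2}})"

definition strictly_weighted :: "'a set \<Rightarrow> ('a \<Rightarrow> nat) \<Rightarrow> bool" where
  "strictly_weighted V \<omega> \<longleftrightarrow> (\<forall>v\<in>V. \<omega> v > 1)"

definition weight_isomorphic ::
  "'a set \<Rightarrow> 'a set set \<Rightarrow> ('a \<Rightarrow> nat) \<Rightarrow> 'b set \<Rightarrow> 'b set set \<Rightarrow> ('b \<Rightarrow> nat) \<Rightarrow> bool" where
  "weight_isomorphic V E \<omega> V' E' \<omega>' \<longleftrightarrow>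
     (\<exists>f. bij_betw f V V' \<and>
          (\<forall>u\<in>V. \<forall>v\<in>V. {u, v} \<in> E \<longleftrightarrow> {f u, f v} \<in> E') \<and>
          (\<forall>v\<in>V. \<omega>' (f v) = \<omega> v))"

text \<open>
  The marks proper are the pairs \<open>(w, d)\<close> with \<open>w \<ge> 1\<close> and \<open>w \<ge> d + 1\<close>. They are closed under the
  dot-sum, so the remaining pairs never occur in the polynomials of a properly marked tree.
\<close>

type_synonym mark = "nat \<times> nat"

definition valid_mark :: "mark \<Rightarrow> bool" where
  "valid_mark = (\<lambda>(w, d). w \<ge> 1 \<and> w \<ge> d + 1)"

definition dotplus :: "mark \<Rightarrow> mark \<Rightarrow> mark" (infixl "\<oplus>\<^sub>m" 65) where
  "m \<oplus>\<^sub>m m' = (fst m + fst m', snd m + snd m' + 1)"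

lemma dotplus_simps [simp]: "(w, d) \<oplus>\<^sub>m (w', d') = (w + w', d + d' + 1)"
  by (simp add: dotplus_def)

lemma valid_mark_dotplus: "valid_mark m \<Longrightarrow> valid_mark m' \<Longrightarrow> valid_mark (m \<oplus>\<^sub>m m')"
  by (cases m; cases m') (auto simp: valid_mark_def)

text \<open>
  The dot-sum has no neutral element, so the iterated dot-sum starts from the mark of an
  arbitrarily chosen vertex; by the lemmas below the choice is immaterial.
\<close>

definition dotsum :: "('a \<Rightarrow> mark) \<Rightarrow> 'a set \<Rightarrow> mark" where
  "dotsum m C =
     (let v = SOME v. v \<in> C in Finite_Set.fold (\<lambda>u x. m u \<oplus>\<^sub>m x) (m v) (C - {v}))"

lemma dotsum_fold:
  assumes "finite C"
  shows "Finite_Set.fold (\<lambda>u x. m u \<oplus>\<^sub>m x) a C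
         = (fst a + (\<Sum>u\<in>C. fst (m u)), snd a + (\<Sum>u\<in>C. snd (m u)) + card C)"
proof -
  interpret comp_fun_commute "\<lambda>u x. m u \<oplus>\<^sub>m x"
    by unfold_locales (auto simp: dotplus_def fun_eq_iff)
  show ?thesis
    using assms
  proof induction
    case (insert x F)
    show ?case
      unfolding fold_insert[OF insert.hyps] insert.IH
      using insert.hyps by (simp add: dotplus_def)
  qed simp
qed

lemma dotsum_eq:
  assumes "finite C" "C \<noteq> {}"
  shows "dotsum m C = (\<Sum>u\<in>C. fst (m u), (\<Sum>u\<in>C. snd (m u)) + (card C - 1))"
proof -
  define v where "v = (SOME v. v \<in> C)"
  have "v \<in> C"
    using assms(2) by (auto simp: v_def some_in_eq)
  then show ?thesis
    using assms(1)
    by (simp add: dotsum_def flip: v_def)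
       (simp add: dotsum_fold sum.remove[of C v])
qed

lemma dotsum_singleton: "dotsum m {v} = m v"
  by (simp add: dotsum_eq)

lemma dotsum_insert:
  assumes "finite C" "C \<noteq> {}" "v \<notin> C"
  shows "dotsum m (insert v C) = m v \<oplus>\<^sub>m dotsum m C"
  using assms by (auto simp: dotsum_eq dotplus_def Suc_le_eq card_gt_0_iff)

text \<open>
  The ring of integer polynomials in the commuting indeterminates \<open>z\<^sub>w\<^sub>,\<^sub>d\<close>: a monomial is a finitely
  supported map from indeterminates to exponents, a polynomial a finitely supported map from
  monomials to coefficients.
\<close>

type_synonym zpoly = "(mark \<Rightarrow>\<^sub>0 nat) \<Rightarrow>\<^sub>0 int"

definition zvar :: "mark \<Rightarrow> zpoly" where
  "zvar m = Poly_Mapping.single (Poly_Mapping.single m 1) 1"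

definition zsubst :: "(mark \<Rightarrow> zpoly) \<Rightarrow> zpoly \<Rightarrow> zpoly" where
  "zsubst f p =
     (\<Sum>\<mu>\<in>Poly_Mapping.keys p. of_int (Poly_Mapping.lookup p \<mu>) *
        (\<Prod>x\<in>Poly_Mapping.keys \<mu>. f x ^ Poly_Mapping.lookup \<mu> x))"

definition M_poly :: "'a set \<Rightarrow> 'a set set \<Rightarrow> ('a \<Rightarrow> mark) \<Rightarrow> zpoly" where
  "M_poly V E m = (\<Sum>A\<in>Pow E. \<Prod>C\<in>components V A. zvar (dotsum m C))"

text \<open>Since \<open>w \<ge> d + 1\<close> for a mark, the subtraction below never truncates.\<close>

definition D_point :: "mark \<Rightarrow> zpoly" where
  "D_point = (\<lambda>(w, d).
     \<Sum>i\<le>d. (-1) ^ i * of_nat (d choose i) * zvar (w - i, 0) * zvar (1, 0) ^ i)"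

definition D_poly :: "'a set \<Rightarrow> 'a set set \<Rightarrow> ('a \<Rightarrow> mark) \<Rightarrow> zpoly" where
  "D_poly V E m = zsubst D_point (M_poly V E m)"

definition weight_marking :: "('a \<Rightarrow> nat) \<Rightarrow> 'a \<Rightarrow> mark" where
  "weight_marking \<omega> v = (\<omega> v, 0)"

end

theory Submission
  imports Defs "HOL-Library.Multiset"
begin

text \<open>
  Modulo \<open>z\<^sub>1\<^sub>,\<^sub>0\<close>, the polynomial \<open>D\<close> of a strictly weighted tree records the multiset, over all edge
  subsets \<open>A\<close>, of the multisets of component weights of \<open>A\<close>; nothing else is needed. Let the centers
  have weights \<open>a\<close> and \<open>b\<close>, with \<open>s\<close> and \<open>r\<close> leaves.
  \<^item> \<open>card A = 0\<close> gives the vertex weights and \<open>card A = 1\<close> the unordered pairs of weights joined by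
    an edge. Counting each vertex weight with its degree minus one leaves \<open>s\<close> times \<open>a\<close> plus \<open>r\<close> times
    \<open>b\<close>, hence the weights of the centers that have leaves. If one center has no leaf, the tree is a
    star and any of its leaves may act as second center, so the two trees may be assumed to have
    equal center weights.
  \<^item> If \<open>a \<noteq> b\<close>, the edge types tell which leaf weights hang at which center.
  \<^item> If \<open>a = b\<close>, let \<open>\<delta> w\<close> be the difference of the numbers of leaves of weight \<open>w\<close> at the two centers.
    Comparing two leaves at the same center with two leaves at different centers, \<open>card A = 2\<close>
    determines all products \<open>\<delta> x * \<delta> y\<close>, by descending induction on \<open>x + y\<close>; so \<open>\<delta>\<close> is known up to
    sign, that is, up to exchanging the centers.
\<close>

section \<open>Reduction to component weights\<close>

definition monomial_subst :: "(mark \<Rightarrow> zpoly) \<Rightarrow> (mark \<Rightarrow>\<^sub>0 nat) \<Rightarrow> zpoly" where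
  "monomial_subst f \<mu> = (\<Prod>x\<in>Poly_Mapping.keys \<mu>. f x ^ Poly_Mapping.lookup \<mu> x)"

text \<open>Exponents outside the support are zero and contribute the factor 1. A common index set
  lets monomials with different supports be multiplied factor by factor.\<close>

lemma monomial_subst_superset:
  assumes "finite K" "Poly_Mapping.keys \<mu> \<subseteq> K"
  shows "monomial_subst f \<mu> = (\<Prod>x\<in>K. f x ^ Poly_Mapping.lookup \<mu> x)"
  unfolding monomial_subst_def
  using assms by (intro prod.mono_neutral_left) (auto simp: in_keys_iff)

lemma monomial_subst_add: "monomial_subst f (\<mu> + \<nu>) = monomial_subst f \<mu> * monomial_subst f \<nu>"
proof -
  let ?K = "Poly_Mapping.keys \<mu> \<union> Poly_Mapping.keys \<nu>"
  have "Poly_Mapping.keys (\<mu> + \<nu>) \<subseteq> ?K"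
    by (auto simp: in_keys_iff lookup_add)
  then show ?thesis
    by (simp add: monomial_subst_superset[of ?K] lookup_add power_add prod.distrib)
qed

lemma monomial_subst_single: "monomial_subst f (Poly_Mapping.single x 1) = f x"
  by (simp add: monomial_subst_def)

lemma monomial_subst_sum_singles:
  "finite I \<Longrightarrow> monomial_subst f (\<Sum>i\<in>I. Poly_Mapping.single (x i) 1) = (\<Prod>i\<in>I. f (x i))"
proof (induction I rule: finite_induct)
  case empty
  then show ?case by (simp add: monomial_subst_def)
next
  case (insert i I)
  then show ?case by (simp add: monomial_subst_add monomial_subst_single del: One_nat_def)
qed

lemma zsubst_superset:
  assumes "finite K" "Poly_Mapping.keys p \<subseteq> K"
  shows "zsubst f p = (\<Sum>\<mu>\<in>K. of_int (Poly_Mapping.lookup p \<mu>) * monomial_subst f \<mu>)"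
  unfolding zsubst_def monomial_subst_def
  using assms by (intro sum.mono_neutral_left) (auto simp: in_keys_iff)

lemma zsubst_add: "zsubst f (p + q) = zsubst f p + zsubst f q"
proof -
  let ?K = "Poly_Mapping.keys p \<union> Poly_Mapping.keys q"
  have "Poly_Mapping.keys (p + q) \<subseteq> ?K"
    by (auto simp: in_keys_iff lookup_add)
  then show ?thesis
    by (simp add: zsubst_superset[of ?K] lookup_add algebra_simps sum.distrib)
qed

lemma zsubst_sum: "finite I \<Longrightarrow> zsubst f (\<Sum>i\<in>I. p i) = (\<Sum>i\<in>I. zsubst f (p i))"
proof (induction I rule: finite_induct)
  case empty
  then show ?case by (simp add: zsubst_def)
qed (simp add: zsubst_add)

lemma zsubst_single: "zsubst f (Poly_Mapping.single \<mu> 1) = monomial_subst f \<mu>"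
  by (simp add: zsubst_def monomial_subst_def)

lemma prod_zvar:
  "finite I \<Longrightarrow> (\<Prod>i\<in>I. zvar (x i)) = Poly_Mapping.single (\<Sum>i\<in>I. Poly_Mapping.single (x i) 1) 1"
  by (induction I rule: finite_induct) (simp_all add: zvar_def mult_single)

lemma finite_components: "finite V \<Longrightarrow> finite (components V A)"
  by (simp add: components_def quotient_def)

text \<open>By \<open>prod_zvar\<close> each edge subset contributes one monomial with coefficient 1
  to \<open>M_poly\<close>, so additivity of \<open>zsubst\<close> and its value at a single
  monomial give the result.\<close>

lemma D_poly_eq_sum_prod:
  assumes "finite V" "finite E"
  shows "D_poly V E m = (\<Sum>A\<in>Pow E. \<Prod>C\<in>components V A. D_point (dotsum m C))"
  using assms
  by (simp add: D_poly_def M_poly_def zsubst_sum prod_zvar finite_components zsubst_single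
      monomial_subst_sum_singles del: One_nat_def)

section \<open>Reduction modulo z_{1,0}\<close>

lemma D_point_mod_z1: "zvar (1, 0) dvd D_point (w, d) - zvar (w, 0)"
proof -
  have "D_point (w, d) - zvar (w, 0) =
      (\<Sum>i\<in>{..d} - {0}. (-1) ^ i * of_nat (d choose i) * zvar (w - i, 0) * zvar (1, 0) ^ i)"
    by (simp add: D_point_def sum.remove[of "{..d}" 0])
  \<comment> \<open>Every remaining index is positive, so each term contains z_{1,0}.\<close>
  also have "zvar (1, 0) dvd \<dots>"
    by (intro dvd_sum dvd_mult dvd_power) auto
  finally show ?thesis .
qed

text \<open>Exchanging one factor at a time changes the product by a multiple of
  \<open>z\<close>.\<close>

lemma dvd_prod_diff:
  fixes f g :: "'i \<Rightarrow> 'c::comm_ring_1"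
  assumes "\<And>i. i \<in> I \<Longrightarrow> z dvd f i - g i"
  shows "z dvd (\<Prod>i\<in>I. f i) - (\<Prod>i\<in>I. g i)"
  using assms
proof (induction I rule: infinite_finite_induct)
  case (insert i I)
  have "prod f (insert i I) - prod g (insert i I) =
      f i * (prod f I - prod g I) + (f i - g i) * prod g I"
    using insert.hyps by (simp add: algebra_simps)
  then show ?case
    using insert by (metis dvd_add dvd_mult dvd_mult2 insertI1 insertI2)
qed auto

text \<open>Every monomial of a multiple of \<open>zvar x\<close> contains \<open>x\<close>. Hence
  coefficients of monomials free of \<open>x\<close> survive reduction modulo
  \<open>zvar x\<close>.\<close>

lemma lookup_eq_0_of_zvar_dvd:
  assumes "zvar x dvd p" "Poly_Mapping.lookup \<mu> x = 0"
  shows "Poly_Mapping.lookup p \<mu> = 0"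
proof (rule ccontr)
  assume "Poly_Mapping.lookup p \<mu> \<noteq> 0"
  moreover obtain r where "p = zvar x * r"
    using assms(1) by blast
  ultimately have "\<mu> \<in> Poly_Mapping.keys (zvar x * r)"
    by (simp add: in_keys_iff)
  then obtain \<nu> where "\<mu> = Poly_Mapping.single x 1 + \<nu>"
    using keys_mult[of "zvar x" r] by (auto simp: zvar_def)
  then show False
    using assms(2) by (simp add: lookup_add)
qed

text \<open>A multiset, so that different components of equal weight are counted separately.\<close>

definition component_weights :: "'a set \<Rightarrow> ('a \<Rightarrow> nat) \<Rightarrow> 'a set set \<Rightarrow> nat multiset" where
  "component_weights V \<omega> A = image_mset (sum \<omega>) (mset_set (components V A))"

definition weight_monomial :: "nat multiset \<Rightarrow> (mark \<Rightarrow>\<^sub>0 nat)" where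
  "weight_monomial M = (\<Sum>w\<in>#M. Poly_Mapping.single (w, 0) 1)"

lemma lookup_weight_monomial: "Poly_Mapping.lookup (weight_monomial M) (w, 0) = count M w"
  by (induction M) (auto simp: weight_monomial_def lookup_add lookup_single when_def)

lemma weight_monomial_eq_iff: "weight_monomial M = weight_monomial N \<longleftrightarrow> M = N"
  by (metis lookup_weight_monomial multiset_eqI)

lemma prod_zvar_component_weights:
  assumes "finite V"
  shows "(\<Prod>C\<in>components V A. zvar (sum \<omega> C, 0)) =
    Poly_Mapping.single (weight_monomial (component_weights V \<omega> A)) 1"
  using finite_components[OF assms]
  by (simp add: prod_zvar weight_monomial_def component_weights_def sum_unfold_sum_mset
      image_mset.compositionality o_def)

lemma component_finite_nonempty:
  assumes "finite V" "C \<in> components V A"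
  shows "C \<subseteq> V" "finite C" "C \<noteq> {}"
proof -
  show "C \<subseteq> V" using assms(2) by (auto simp: components_def quotient_def)
  then show "finite C" using assms(1) finite_subset by blast
  show "C \<noteq> {}" using assms(2) by (auto simp: components_def quotient_def)
qed

lemma D_poly_mod_z1:
  assumes "finite V" "finite E"
  shows "zvar (1, 0) dvd D_poly V E (weight_marking \<omega>) -
    (\<Sum>A\<in>Pow E. Poly_Mapping.single (weight_monomial (component_weights V \<omega> A)) 1)"
proof -
  have "zvar (1, 0) dvd (\<Prod>C\<in>components V A. D_point (dotsum (weight_marking \<omega>) C)) -
      (\<Prod>C\<in>components V A. zvar (sum \<omega> C, 0))" for A
  proof (rule dvd_prod_diff)
    fix C assume "C \<in> components V A"
    from component_finite_nonempty[OF assms(1) this]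
    show "zvar (1, 0) dvd D_point (dotsum (weight_marking \<omega>) C) - zvar (sum \<omega> C, 0)"
      using D_point_mod_z1[of "sum \<omega> C"] by (simp add: dotsum_eq weight_marking_def)
  qed
  then have "zvar (1, 0) dvd (\<Sum>A\<in>Pow E.
      (\<Prod>C\<in>components V A. D_point (dotsum (weight_marking \<omega>) C)) -
      (\<Prod>C\<in>components V A. zvar (sum \<omega> C, 0)))"
    by (intro dvd_sum) auto
  then show ?thesis
    using assms by (simp add: D_poly_eq_sum_prod sum_subtractf prod_zvar_component_weights)
qed

text \<open>All coefficients are 1, so nothing cancels and a coefficient is a multiplicity. This
  turns identities of polynomials into identities of multisets.\<close>

lemma lookup_sum_weight_monomials:
  assumes "finite F"
  shows "Poly_Mapping.lookup (\<Sum>A\<in>F. Poly_Mapping.single (weight_monomial (t A)) (1::int))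
      (weight_monomial M) = int (count (image_mset t (mset_set F)) M)"
  using assms
  by (induction F rule: finite_induct)
    (auto simp: lookup_add lookup_single when_def weight_monomial_eq_iff)

text \<open>A component weighs at least as much as each of its vertices, hence more than 1. So
  z_{1,0} occurs in no weight monomial, and reduction modulo z_{1,0} loses none of them.\<close>

lemma one_notin_component_weights:
  assumes "finite V" "strictly_weighted V \<omega>"
  shows "1 \<notin># component_weights V \<omega> A"
proof
  assume "1 \<in># component_weights V \<omega> A"
  then obtain C where C: "C \<in> components V A" "sum \<omega> C = 1"
    using finite_components[OF assms(1)] by (auto simp: component_weights_def)
  note 1 = component_finite_nonempty[OF assms(1) C(1)]
  then obtain v where "v \<in> C" by auto
  then have "\<omega> v \<le> sum \<omega> C" using 1 by (intro member_le_sum) auto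
  then show False using C \<open>v \<in> C\<close> 1 assms(2) by (force simp: strictly_weighted_def)
qed

lemma D_poly_determines_component_weights:
  assumes "finite V" "finite E" "strictly_weighted V \<omega>"
    and "finite V'" "finite E'" "strictly_weighted V' \<omega>'"
    and "D_poly V E (weight_marking \<omega>) = D_poly V' E' (weight_marking \<omega>')"
  shows "image_mset (component_weights V \<omega>) (mset_set (Pow E)) =
    image_mset (component_weights V' \<omega>') (mset_set (Pow E'))"
proof (rule multiset_eqI)
  fix M
  let ?p = "\<Sum>A\<in>Pow E. Poly_Mapping.single (weight_monomial (component_weights V \<omega> A)) (1::int)"
  let ?q = "\<Sum>A\<in>Pow E'. Poly_Mapping.single (weight_monomial (component_weights V' \<omega>' A)) (1::int)"
  show "count (image_mset (component_weights V \<omega>) (mset_set (Pow E))) M =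
    count (image_mset (component_weights V' \<omega>') (mset_set (Pow E'))) M"
  \<comment> \<open>Multisets containing 1 occur on neither side; for the others the coefficient
    does not change under adding multiples of z_{1,0}.\<close>
  proof (cases "1 \<in># M")
    case True
    have "M \<notin># image_mset (component_weights V \<omega>) (mset_set (Pow E))"
      "M \<notin># image_mset (component_weights V' \<omega>') (mset_set (Pow E'))"
      using True one_notin_component_weights[OF assms(1,3)] one_notin_component_weights[OF assms(4,6)]
      by auto
    then show ?thesis by (metis not_in_iff)
  next
    case False
    have "zvar (1, 0) dvd ?q - ?p"
      using dvd_diff[OF D_poly_mod_z1[OF assms(1,2), of \<omega>] D_poly_mod_z1[OF assms(4,5), of \<omega>']] assms(7)
      by simp
    then have "Poly_Mapping.lookup (?q - ?p) (weight_monomial M) = 0"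
      using False
      by (intro lookup_eq_0_of_zvar_dvd) (auto simp: lookup_weight_monomial not_in_iff)
    then show ?thesis
      using assms(2,5) by (simp add: lookup_minus lookup_sum_weight_monomials)
  qed
qed

section \<open>Edge subsets of 2-stars\<close>

text \<open>\<open>f\<close> picks a root in each component. Constancy along edges gives connected
  vertices the same root; paths to the root connect vertices that share it.\<close>

lemma components_eq_fibres:
  assumes same: "\<And>u v. {u, v} \<in> A \<Longrightarrow> f u = f v"
    and root: "\<And>v. v \<in> V \<Longrightarrow> f v \<in> V"
    and path: "\<And>v. v \<in> V \<Longrightarrow> (v, f v) \<in> {(x, y). {x, y} \<in> A}\<^sup>*"
  shows "components V A = (\<lambda>y. {u \<in> V. f u = y}) ` f ` V"
proof -
  let ?R = "{(x, y). {x, y} \<in> A}"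
  have sym: "sym (?R\<^sup>*)"
    by (intro sym_rtrancl) (auto simp: sym_def insert_commute)
  have const: "f u = f v" if "(u, v) \<in> ?R\<^sup>*" for u v
    using that by (induction rule: rtrancl_induct) (auto dest: same)
  have "(u, v) \<in> ?R\<^sup>* \<longleftrightarrow> f u = f v" if "u \<in> V" "v \<in> V" for u v
  proof
    assume "f u = f v"
    then have "(u, f v) \<in> ?R\<^sup>*" "(f v, v) \<in> ?R\<^sup>*"
      using path[OF that(1)] path[OF that(2)] sym by (auto dest: symD)
    then show "(u, v) \<in> ?R\<^sup>*" by (rule rtrancl_trans)
  qed (rule const)
  then have "{(u, v). u \<in> V \<and> v \<in> V \<and> (u, v) \<in> ?R\<^sup>*} = {(u, v). u \<in> V \<and> v \<in> V \<and> f u = f v}"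
    by auto
  moreover have "{v. (u, v) \<in> {(u, v). u \<in> V \<and> v \<in> V \<and> f u = f v}} = {v \<in> V. f v = f u}"
    if "u \<in> V" for u
    using that by auto
  ultimately show ?thesis
    unfolding components_def quotient_def by (auto simp: Image_singleton image_image)
qed

lemma component_weights_eq_fibres:
  assumes "\<And>u v. {u, v} \<in> A \<Longrightarrow> f u = f v"
    and "\<And>v. v \<in> V \<Longrightarrow> f v \<in> V"
    and "\<And>v. v \<in> V \<Longrightarrow> (v, f v) \<in> {(x, y). {x, y} \<in> A}\<^sup>*"
  shows "component_weights V \<omega> A =
    image_mset (\<lambda>y. sum \<omega> {u \<in> V. f u = y}) (mset_set (f ` V))"
proof -
  \<comment> \<open>Fibres over points of the image are nonempty, so different roots have different
    fibres.\<close>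
  have "inj_on (\<lambda>y. {u \<in> V. f u = y}) (f ` V)"
    by (rule inj_onI) blast
  then have "mset_set (components V A) = image_mset (\<lambda>y. {u \<in> V. f u = y}) (mset_set (f ` V))"
    using components_eq_fibres[OF assms] by (simp add: image_mset_mset_set)
  then show ?thesis
    by (simp add: component_weights_def image_mset.compositionality o_def)
qed

text \<open>A chosen presentation of a 2-star: centers \<open>p\<close> and \<open>q\<close> with
  their leaf sets \<open>L\<close> and \<open>R\<close>. One tree may have several presentations,
  and this freedom is used to match the centers of two trees.\<close>

definition two_star_at :: "'a set \<Rightarrow> 'a set set \<Rightarrow> 'a \<Rightarrow> 'a \<Rightarrow> 'a set \<Rightarrow> 'a set \<Rightarrow> bool" where
  "two_star_at V E p q L R \<longleftrightarrow>
     finite L \<and> finite R \<and> L \<inter> R = {} \<and> p \<noteq> q \<and> p \<notin> L \<union> R \<and> q \<notin> L \<union> R \<and>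
     V = {p, q} \<union> L \<union> R \<and> E = insert {p, q} ((\<lambda>v. {p, v}) ` L \<union> (\<lambda>v. {q, v}) ` R)"

lemma two_star_imp_two_star_at:
  assumes "two_star V E"
  obtains p q L R where "two_star_at V E p q L R"
proof -
  obtain V1 E1 p V2 E2 q where *: "star_with_center V1 E1 p" "star_with_center V2 E2 q"
    "V1 \<inter> V2 = {}" "V = V1 \<union> V2" "E = E1 \<union> E2 \<union> {{p, q}}"
    using assms unfolding two_star_def by blast
  then have "two_star_at V E p q (V1 - {p}) (V2 - {q})"
    unfolding two_star_at_def star_with_center_def by (auto simp: image_def)
  then show ?thesis by (rule that)
qed

lemma two_star_at_swap: "two_star_at V E p q L R \<Longrightarrow> two_star_at V E q p R L"
  unfolding two_star_at_def by (auto simp: insert_commute)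

text \<open>Without leaves at \<open>q\<close> the tree is a star around \<open>p\<close>, and
  \<open>q\<close> is a leaf like any other.\<close>

lemma two_star_at_change_center:
  assumes "two_star_at V E p q L {}" "v \<in> L"
  shows "two_star_at V E p v (insert q (L - {v})) {}"
  using assms unfolding two_star_at_def by (auto simp: insert_commute)

text \<open>\<open>S\<close> is the set of leaves whose edges are kept, and the center edge is
  absent. Kept leaves have their center as root; all other leaves are isolated.\<close>

lemma component_weights_cut:
  assumes "two_star_at V E p q L R" "S \<subseteq> L \<union> R"
  shows "component_weights V \<omega> ((\<lambda>v. {p, v}) ` (L \<inter> S) \<union> (\<lambda>v. {q, v}) ` (R \<inter> S)) =
    {#\<omega> p + sum \<omega> (L \<inter> S), \<omega> q + sum \<omega> (R \<inter> S)#} + image_mset \<omega> (mset_set (L \<union> R - S))"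
    (is "component_weights V \<omega> ?A = _")
proof -
  define f where "f v = (if v \<in> L \<inter> S then p else if v \<in> R \<inter> S then q else v)" for v
  note T = assms(1)[unfolded two_star_at_def]
  have "component_weights V \<omega> ?A = image_mset (\<lambda>y. sum \<omega> {u \<in> V. f u = y}) (mset_set (f ` V))"
  proof (rule component_weights_eq_fibres)
    show "f u = f v" if "{u, v} \<in> ?A" for u v
    proof -
      have centers: "f p = p" "f q = q"
        using T by (simp_all add: f_def)
      from that obtain x where "x \<in> L \<inter> S \<and> {u, v} = {p, x} \<or> x \<in> R \<inter> S \<and> {u, v} = {q, x}"
        by blast
      moreover have "f x = p" if "x \<in> L \<inter> S"
        using that by (simp add: f_def)
      moreover have "f x = q" if "x \<in> R \<inter> S"
        using that T by (auto simp: f_def)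
      ultimately show ?thesis
        using centers by (metis doubleton_eq_iff)
    qed
    show "f v \<in> V" if "v \<in> V" for v
      using that T by (auto simp: f_def)
    show "(v, f v) \<in> {(x, y). {x, y} \<in> ?A}\<^sup>*" if "v \<in> V" for v
    proof (cases "v \<in> S")
      case True
      then show ?thesis
        using that T by (auto simp: f_def insert_commute intro!: r_into_rtrancl)
    qed (auto simp: f_def)
  qed
  also have "f ` V = {p, q} \<union> (L \<union> R - S)"
    using T assms(2) by (auto simp: f_def image_iff)
  also have "mset_set \<dots> = {#p, q#} + mset_set (L \<union> R - S)"
    using T by (subst mset_set_Union) auto
  also have "image_mset (\<lambda>y. sum \<omega> {u \<in> V. f u = y}) \<dots> =
    {#\<omega> p + sum \<omega> (L \<inter> S), \<omega> q + sum \<omega> (R \<inter> S)#} + image_mset \<omega> (mset_set (L \<union> R - S))"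
  proof -
    have "{u \<in> V. f u = p} = insert p (L \<inter> S)" "{u \<in> V. f u = q} = insert q (R \<inter> S)"
      using T by (auto simp: f_def split: if_splits)
    moreover have "{u \<in> V. f u = y} = {y}" if "y \<in> L \<union> R - S" for y
      using T that by (auto simp: f_def split: if_splits)
    then have "image_mset (\<lambda>y. sum \<omega> {u \<in> V. f u = y}) (mset_set (L \<union> R - S)) =
      image_mset \<omega> (mset_set (L \<union> R - S))"
      using T by (intro image_mset_cong) auto
    ultimately show ?thesis using T by simp
  qed
  finally show ?thesis .
qed

text \<open>The center edge merges the components of the two centers; \<open>p\<close> is their
  common root.\<close>

lemma component_weights_joined:
  assumes "two_star_at V E p q L R" "S \<subseteq> L \<union> R"
  shows "component_weights V \<omega>
      (insert {p, q} ((\<lambda>v. {p, v}) ` (L \<inter> S) \<union> (\<lambda>v. {q, v}) ` (R \<inter> S))) =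
    {#\<omega> p + \<omega> q + sum \<omega> S#} + image_mset \<omega> (mset_set (L \<union> R - S))"
    (is "component_weights V \<omega> ?A = _")
proof -
  define f where "f v = (if v \<in> insert q S then p else v)" for v
  note T = assms(1)[unfolded two_star_at_def]
  have "component_weights V \<omega> ?A = image_mset (\<lambda>y. sum \<omega> {u \<in> V. f u = y}) (mset_set (f ` V))"
  proof (rule component_weights_eq_fibres)
    show "f u = f v" if "{u, v} \<in> ?A" for u v
      using that T by (auto simp: f_def doubleton_eq_iff)
    show "f v \<in> V" if "v \<in> V" for v
      using that T by (auto simp: f_def)
    have q: "(q, p) \<in> {(x, y). {x, y} \<in> ?A}\<^sup>*"
      by (auto simp: insert_commute)
    show "(v, f v) \<in> {(x, y). {x, y} \<in> ?A}\<^sup>*" if "v \<in> V" for v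
    \<comment> \<open>Only the kept leaves at \<open>q\<close> need two edges to reach the root, by
      way of \<open>q\<close>.\<close>
    proof (cases "v \<in> R \<inter> S")
      case True
      then have "(v, q) \<in> {(x, y). {x, y} \<in> ?A}\<^sup>*"
        by (auto simp: insert_commute intro!: r_into_rtrancl)
      then show ?thesis
        using q True by (auto simp: f_def)
    next
      case False
      then show ?thesis
        using that q assms(2) by (auto simp: f_def insert_commute intro!: r_into_rtrancl)
    qed
  qed
  also have "f ` V = {p} \<union> (L \<union> R - S)"
    using T assms(2) by (auto simp: f_def image_iff)
  also have "mset_set \<dots> = {#p#} + mset_set (L \<union> R - S)"
    using T by (subst mset_set_Union) auto
  also have "image_mset (\<lambda>y. sum \<omega> {u \<in> V. f u = y}) \<dots> =
    {#\<omega> p + \<omega> q + sum \<omega> S#} + image_mset \<omega> (mset_set (L \<union> R - S))"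
  proof -
    have "{u \<in> V. f u = p} = insert p (insert q S)" "p \<notin> S" "q \<notin> S"
      using T assms(2) by (auto simp: f_def split: if_splits)
    moreover have "finite S"
      using T assms(2) finite_subset by blast
    moreover have "{u \<in> V. f u = y} = {y}" if "y \<in> L \<union> R - S" for y
      using T that by (auto simp: f_def split: if_splits)
    then have "image_mset (\<lambda>y. sum \<omega> {u \<in> V. f u = y}) (mset_set (L \<union> R - S)) =
      image_mset \<omega> (mset_set (L \<union> R - S))"
      using T by (intro image_mset_cong) auto
    ultimately show ?thesis using T by (simp add: add.assoc)
  qed
  finally show ?thesis .
qed

text \<open>Identifying each leaf with its edge turns an edge subset into a set \<open>S\<close> of
  leaves and the choice whether the center edge belongs to it. \<open>F\<close> is a test function
  through which single invariants are extracted.\<close>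

lemma sum_over_edge_subsets:
  fixes F :: "nat multiset \<Rightarrow> int"
  assumes "two_star_at V E p q L R"
  shows "(\<Sum>A\<in>Pow E. F (component_weights V \<omega> A)) =
    (\<Sum>S\<in>Pow (L \<union> R).
       F ({#\<omega> p + sum \<omega> (L \<inter> S), \<omega> q + sum \<omega> (R \<inter> S)#} + image_mset \<omega> (mset_set (L \<union> R - S))) +
       F ({#\<omega> p + \<omega> q + sum \<omega> S#} + image_mset \<omega> (mset_set (L \<union> R - S))))"
proof -
  note T = assms(1)[unfolded two_star_at_def]
  define e where "e v = (if v \<in> L then {p, v} else {q, v})" for v
  have e_image: "e ` S = (\<lambda>v. {p, v}) ` (L \<inter> S) \<union> (\<lambda>v. {q, v}) ` (R \<inter> S)" if "S \<subseteq> L \<union> R" for S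
    using T that by (auto simp: e_def)
  have E: "E = insert {p, q} (e ` (L \<union> R))"
    using T e_image[of "L \<union> R"] by (simp add: Int_absorb2 Int_absorb1 inf_sup_absorb inf.absorb1)
  have notin: "{p, q} \<notin> e ` (L \<union> R)"
    using T by (auto simp: e_def doubleton_eq_iff split: if_splits)
  have inj: "inj_on e (L \<union> R)"
    using T by (auto simp: e_def inj_on_def doubleton_eq_iff split: if_splits)
  let ?G = "\<lambda>A. F (component_weights V \<omega> A)"
  have "(\<Sum>A\<in>Pow E. ?G A) = (\<Sum>A\<in>Pow (e ` (L \<union> R)). ?G A) + (\<Sum>A\<in>insert {p, q} ` Pow (e ` (L \<union> R)). ?G A)"
    unfolding E Pow_insert using T notin by (intro sum.union_disjoint) auto
  also have "(\<Sum>A\<in>insert {p, q} ` Pow (e ` (L \<union> R)). ?G A) = (\<Sum>A\<in>Pow (e ` (L \<union> R)). ?G (insert {p, q} A))"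
    using notin by (subst sum.reindex) (auto intro!: inj_onI dest: insert_ident[THEN iffD1, rotated 2] simp: o_def)
  also have "(\<Sum>A\<in>Pow (e ` (L \<union> R)). ?G A) + \<dots> =
      (\<Sum>A\<in>Pow (e ` (L \<union> R)). ?G A + ?G (insert {p, q} A))"
    by (simp add: sum.distrib)
  also have "\<dots> = (\<Sum>S\<in>Pow (L \<union> R). ?G (e ` S) + ?G (insert {p, q} (e ` S)))"
    using inj_on_image_Pow[OF inj] by (simp add: sum.reindex image_Pow_surj[OF refl, symmetric] o_def)
  also have "\<dots> = (\<Sum>S\<in>Pow (L \<union> R).
       F ({#\<omega> p + sum \<omega> (L \<inter> S), \<omega> q + sum \<omega> (R \<inter> S)#} + image_mset \<omega> (mset_set (L \<union> R - S))) +
       F ({#\<omega> p + \<omega> q + sum \<omega> S#} + image_mset \<omega> (mset_set (L \<union> R - S))))"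
    using assms by (intro sum.cong refl)
      (simp add: e_image component_weights_cut component_weights_joined)
  finally show ?thesis .
qed

section \<open>Isomorphisms from matching leaf weights\<close>

lemma mset_set_image_eq_imp_bij:
  assumes "finite A" "finite B" "image_mset f (mset_set A) = image_mset g (mset_set B)"
  obtains h where "bij_betw h A B" "\<And>x. x \<in> A \<Longrightarrow> g (h x) = f x"
proof -
  have "\<exists>h. bij_betw h A B \<and> (\<forall>x\<in>A. g (h x) = f x)"
    using assms
  proof (induction A arbitrary: B rule: finite_induct)
    case empty
    then show ?case by (auto simp: mset_set_empty_iff bij_betw_def)
  next
    case (insert a A)
    \<comment> \<open>\<open>a\<close> is matched with some \<open>b\<close> of the same value; both
      are then removed.\<close>
    have "f a \<in># image_mset g (mset_set B)"
      using insert.hyps by (simp flip: insert.prems(2))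
    then obtain b where b: "b \<in> B" "g b = f a"
      using insert.prems(1) by auto
    then have "image_mset f (mset_set A) = image_mset g (mset_set (B - {b}))"
      using insert.prems insert.hyps by (simp add: mset_set.remove)
    then obtain h where h: "bij_betw h A (B - {b})" "\<forall>x\<in>A. g (h x) = f x"
      using insert.IH[of "B - {b}"] insert.prems(1) by auto
    let ?h = "h(a := b)"
    have "bij_betw ?h A (B - {b})"
      using h(1) insert.hyps by (subst bij_betw_cong[of _ _ h]) auto
    then have "bij_betw ?h (insert a A) (insert b (B - {b}))"
      using insert.hyps notIn_Un_bij_betw3[of a A ?h "B - {b}"] by simp
    moreover have "insert b (B - {b}) = B"
      using b by auto
    moreover have "\<forall>x\<in>insert a A. g (?h x) = f x"
      using b h(2) insert.hyps by auto
    ultimately show ?case by metis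
  qed
  then show ?thesis using that by blast
qed

lemma weight_isomorphic_of_leaf_weights:
  assumes T: "two_star_at V E p q L R" and T': "two_star_at V' E' p' q' L' R'"
    and p: "\<omega> p = \<omega>' p'" and q: "\<omega> q = \<omega>' q'"
    and L: "image_mset \<omega> (mset_set L) = image_mset \<omega>' (mset_set L')"
    and R: "image_mset \<omega> (mset_set R) = image_mset \<omega>' (mset_set R')"
  shows "weight_isomorphic V E \<omega> V' E' \<omega>'"
proof -
  note T = T[unfolded two_star_at_def] and T' = T'[unfolded two_star_at_def]
  obtain h where h: "bij_betw h L L'" "\<And>x. x \<in> L \<Longrightarrow> \<omega>' (h x) = \<omega> x"
    using mset_set_image_eq_imp_bij[OF _ _ L] T T' by blast
  obtain k where k: "bij_betw k R R'" "\<And>x. x \<in> R \<Longrightarrow> \<omega>' (k x) = \<omega> x"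
    using mset_set_image_eq_imp_bij[OF _ _ R] T T' by blast
  define f where "f v = (if v = p then p' else if v = q then q' else if v \<in> L then h v else k v)" for v
  have fL: "bij_betw f L L'"
    using h(1) T by (subst bij_betw_cong[of _ _ h]) (auto simp: f_def)
  have fR: "bij_betw f R R'"
    using k(1) T by (subst bij_betw_cong[of _ _ k]) (auto simp: f_def)
  have fpq: "bij_betw f {p, q} {p', q'}"
    using T T' by (auto simp: f_def bij_betw_def)
  have bij: "bij_betw f V V'"
    using bij_betw_combine[OF bij_betw_combine[OF fpq fL] fR] T T' by auto
  have f_pq: "f p = p'" "f q = q'"
    using T by (auto simp: f_def)
  \<comment> \<open>As \<open>f\<close> is injective on \<open>V\<close>, mapping \<open>E\<close>
    onto \<open>E'\<close> makes it both preserve and reflect edges.\<close>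
  have "E' = (`) f ` E"
    using T T' fL fR f_pq by (auto simp: image_Un image_image bij_betw_def)
  moreover have "inj_on f V" "\<And>e. e \<in> E \<Longrightarrow> e \<subseteq> V"
    using bij T by (auto simp: bij_betw_def)
  ultimately have "{u, v} \<in> E \<longleftrightarrow> {f u, f v} \<in> E'" if "u \<in> V" "v \<in> V" for u v
    using that inj_on_image_eq_iff[of f V "{u, v}"] by (auto simp: image_iff)
  moreover have "\<forall>v\<in>V. \<omega>' (f v) = \<omega> v"
    using T p q h(2) k(2) by (auto simp: f_def)
  ultimately show ?thesis
    unfolding weight_isomorphic_def using bij by blast
qed

section \<open>Invariants read off from the empty edge set and from single edges\<close>

definition vertex_weights :: "('a \<Rightarrow> nat) \<Rightarrow> 'a set \<Rightarrow> nat multiset" where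
  "vertex_weights \<omega> L = image_mset \<omega> (mset_set L)"

text \<open>Each kept edge lowers the number of components by one, so the size condition selects the
  subsets with \<open>k\<close> edges: \<open>k\<close> leaf edges, or the center edge and
  \<open>k - 1\<close> leaf edges. The bound on \<open>k\<close> keeps the natural subtraction
  exact.\<close>

lemma sum_of_size:
  fixes G :: "nat multiset \<Rightarrow> int"
  assumes T: "two_star_at V E p q L R" and k: "k \<le> 2"
  shows "(\<Sum>A\<in>Pow E. if size (component_weights V \<omega> A) = card (L \<union> R) + 2 - k
            then G (component_weights V \<omega> A) else 0) =
    (\<Sum>S | S \<subseteq> L \<union> R \<and> card S = k.
       G ({#\<omega> p + sum \<omega> (L \<inter> S), \<omega> q + sum \<omega> (R \<inter> S)#} + image_mset \<omega> (mset_set (L \<union> R - S)))) +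
    (\<Sum>S | S \<subseteq> L \<union> R \<and> card S + 1 = k.
       G ({#\<omega> p + \<omega> q + sum \<omega> S#} + image_mset \<omega> (mset_set (L \<union> R - S))))"
proof -
  have fin: "finite (L \<union> R)"
    using T by (simp add: two_star_at_def)
  have card: "card S \<le> card (L \<union> R)" "card (L \<union> R - S) = card (L \<union> R) - card S" if "S \<subseteq> L \<union> R" for S
    using that fin by (auto simp: card_mono card_Diff_subset finite_subset)
  have restrict: "(\<Sum>S\<in>Pow (L \<union> R). if P S then g S else 0) = (\<Sum>S | S \<subseteq> L \<union> R \<and> P S. g S)"
    for g :: "'a set \<Rightarrow> int" and P
    using fin by (subst sum.inter_filter[symmetric]) (auto simp: Pow_def)
  let ?cut = "\<lambda>S. {#\<omega> p + sum \<omega> (L \<inter> S), \<omega> q + sum \<omega> (R \<inter> S)#} + image_mset \<omega> (mset_set (L \<union> R - S))"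
  let ?join = "\<lambda>S. {#\<omega> p + \<omega> q + sum \<omega> S#} + image_mset \<omega> (mset_set (L \<union> R - S))"
  let ?F = "\<lambda>M. if size M = card (L \<union> R) + 2 - k then G M else 0"
  have "(\<Sum>A\<in>Pow E. ?F (component_weights V \<omega> A)) = (\<Sum>S\<in>Pow (L \<union> R). ?F (?cut S) + ?F (?join S))"
    by (rule sum_over_edge_subsets[OF T])
  also have "\<dots> = (\<Sum>S\<in>Pow (L \<union> R). (if card S = k then G (?cut S) else 0) +
      (if card S + 1 = k then G (?join S) else 0))"
  proof (rule sum.cong[OF refl])
    fix S assume "S \<in> Pow (L \<union> R)"
    then have "size (?cut S) = card (L \<union> R) + 2 - card S" "size (?join S) = card (L \<union> R) + 1 - card S"
      and "card S \<le> card (L \<union> R)"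
      using card[of S] by auto
    then have "size (?cut S) = card (L \<union> R) + 2 - k \<longleftrightarrow> card S = k"
      "size (?join S) = card (L \<union> R) + 2 - k \<longleftrightarrow> card S + 1 = k"
      using k by arith+
    then show "?F (?cut S) + ?F (?join S) = (if card S = k then G (?cut S) else 0) +
      (if card S + 1 = k then G (?join S) else 0)"
      by presburger
  qed
  finally show ?thesis
    by (simp add: sum.distrib restrict)
qed

lemma subsets_card_1: "{S. S \<subseteq> A \<and> card S = 1} = (\<lambda>v. {v}) ` A"
  by (auto simp: card_1_singleton_iff)

lemma subsets_card_0: "finite A \<Longrightarrow> {S. S \<subseteq> A \<and> card S = 0} = {{}}"
  using finite_subset by fastforce

lemma sum_subsets_card_1: "(\<Sum>S | S \<subseteq> A \<and> card S = 1. h S) = (\<Sum>v\<in>A. h {v})"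
  unfolding subsets_card_1 by (subst sum.reindex) auto

text \<open>Every two-element set arises from exactly two ordered pairs.\<close>

lemma sum_subsets_card_2:
  fixes h :: "'a set \<Rightarrow> int"
  assumes "finite A"
  shows "2 * (\<Sum>S | S \<subseteq> A \<and> card S = 2. h S) = (\<Sum>u\<in>A. \<Sum>v\<in>A - {u}. h {u, v})"
proof -
  let ?D = "SIGMA u:A. A - {u}"
  have "(\<Sum>u\<in>A. \<Sum>v\<in>A - {u}. h {u, v}) = (\<Sum>(u, v)\<in>?D. h {u, v})"
    using assms by (intro sum.Sigma) auto
  also have "\<dots> = (\<Sum>S | S \<subseteq> A \<and> card S = 2. \<Sum>x\<in>{x \<in> ?D. {fst x, snd x} = S}. h {fst x, snd x})"
    using assms by (subst sum.group) (auto simp: case_prod_beta)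
  also have "\<dots> = (\<Sum>S | S \<subseteq> A \<and> card S = 2. 2 * h S)"
  proof (rule sum.cong[OF refl])
    fix S assume "S \<in> {S. S \<subseteq> A \<and> card S = 2}"
    then obtain u v where S: "S = {u, v}" "u \<noteq> v" "u \<in> A" "v \<in> A"
      by (auto simp: card_2_iff)
    then have "{x \<in> ?D. {fst x, snd x} = S} = {(u, v), (v, u)}"
      by (auto simp: doubleton_eq_iff)
    then show "(\<Sum>x\<in>{x \<in> ?D. {fst x, snd x} = S}. h {fst x, snd x}) = 2 * h S"
      using S by (simp add: insert_commute)
  qed
  finally show ?thesis by (simp add: sum_distrib_left)
qed

lemma vertex_weights_Un:
  "finite L \<Longrightarrow> finite R \<Longrightarrow> L \<inter> R = {} \<Longrightarrow> vertex_weights \<omega> (L \<union> R) = vertex_weights \<omega> L + vertex_weights \<omega> R"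
  by (simp add: vertex_weights_def mset_set_Union)

lemma vertex_weights_remove:
  "finite L \<Longrightarrow> v \<in> L \<Longrightarrow> vertex_weights \<omega> L = add_mset (\<omega> v) (vertex_weights \<omega> (L - {v}))"
  by (simp add: vertex_weights_def mset_set.remove)

lemma vertex_weights_two_star:
  assumes "two_star_at V E p q L R"
  shows "vertex_weights \<omega> V = {#\<omega> p, \<omega> q#} + vertex_weights \<omega> L + vertex_weights \<omega> R"
proof -
  note T = assms[unfolded two_star_at_def]
  have "vertex_weights \<omega> V = vertex_weights \<omega> {p, q} + vertex_weights \<omega> (L \<union> R)"
    using T vertex_weights_Un[of "{p, q}" "L \<union> R" \<omega>] by (simp add: Un_assoc)
  then show ?thesis
    using T by (simp add: vertex_weights_Un) (simp add: vertex_weights_def)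
qed

text \<open>Edges are labelled by multisets so that their ends may have equal weights.\<close>

definition edge_types :: "('a \<Rightarrow> nat) \<Rightarrow> 'a \<Rightarrow> 'a \<Rightarrow> 'a set \<Rightarrow> 'a set \<Rightarrow> nat multiset multiset" where
  "edge_types \<omega> p q L R = add_mset {#\<omega> p, \<omega> q#}
     (image_mset (\<lambda>v. {#\<omega> p, \<omega> v#}) (mset_set L) + image_mset (\<lambda>v. {#\<omega> q, \<omega> v#}) (mset_set R))"

lemma count_image_mset_set:
  "finite A \<Longrightarrow> int (count (image_mset f (mset_set A)) x) = (\<Sum>v\<in>A. of_bool (f v = x))"
  by (induction A rule: finite_induct) auto

text \<open>The first hypothesis says, without subtraction, that \<open>M\<close> arises from
  \<open>W\<close> by merging \<open>P\<close> into its sum. Cancelling \<open>M\<close> and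
  \<open>W\<close> leaves an equation in which the sum of \<open>P\<close>, not lying in
  \<open>P\<close>, must be the sum of \<open>Q\<close>.\<close>

lemma merged_pair_iff:
  fixes M W P Q :: "nat multiset"
  assumes "M + P = add_mset (sum_mset P) W" and "sum_mset P \<notin># P"
  shows "M + Q = add_mset (sum_mset Q) W \<longleftrightarrow> P = Q"
proof
  assume "M + Q = add_mset (sum_mset Q) W"
  then have "add_mset (sum_mset P) W + Q = add_mset (sum_mset Q) W + P"
    by (metis assms(1) add.assoc add.commute)
  then have "W + add_mset (sum_mset P) Q = W + add_mset (sum_mset Q) P"
    by simp
  then have eq: "add_mset (sum_mset P) Q = add_mset (sum_mset Q) P"
    by (simp only: add_left_cancel)
  then have "sum_mset P = sum_mset Q"
    using assms(2) by (metis insert_noteq_member)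
  then show "P = Q"
    using eq by simp
qed (use assms in auto)

text \<open>The selected subsets are single edges, each of which merges the weights of its two ends.
  Positivity keeps the sum different from both weights, so \<open>merged_pair_iff\<close> recovers
  the pair.\<close>

lemma count_edge_types:
  assumes T: "two_star_at V E p q L R" and pos: "\<forall>v\<in>V. \<omega> v > 0"
  shows "int (count (edge_types \<omega> p q L R) Q) =
    (\<Sum>A\<in>Pow E. if size (component_weights V \<omega> A) = card (L \<union> R) + 2 - 1
       then of_bool (component_weights V \<omega> A + Q = add_mset (sum_mset Q) (vertex_weights \<omega> V)) else 0)"
proof -
  note T' = T[unfolded two_star_at_def]
  let ?W = "vertex_weights \<omega> V"
  let ?G = "\<lambda>M. of_bool (M + Q = add_mset (sum_mset Q) ?W) :: int"
  have W: "?W = {#\<omega> p, \<omega> q#} + vertex_weights \<omega> (L \<union> R)"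
    using vertex_weights_two_star[OF T] T' by (simp add: vertex_weights_Un)
  have Wv: "?W = {#\<omega> p, \<omega> q, \<omega> v#} + vertex_weights \<omega> (L \<union> R - {v})" if "v \<in> L \<union> R" for v
    using W vertex_weights_remove[of "L \<union> R" v \<omega>] that T' by simp
  have L: "?G ({#\<omega> p + sum \<omega> (L \<inter> {v}), \<omega> q + sum \<omega> (R \<inter> {v})#} + vertex_weights \<omega> (L \<union> R - {v})) =
      of_bool ({#\<omega> p, \<omega> v#} = Q)" if "v \<in> L" for v
  proof -
    have "L \<inter> {v} = {v}" "R \<inter> {v} = {}" using that T' by auto
    moreover have "\<omega> p > 0" "\<omega> v > 0" using that T' pos by auto
    ultimately show ?thesis
      using Wv[of v] that by (subst merged_pair_iff[where P = "{#\<omega> p, \<omega> v#}"]) auto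
  qed
  have R: "?G ({#\<omega> p + sum \<omega> (L \<inter> {v}), \<omega> q + sum \<omega> (R \<inter> {v})#} + vertex_weights \<omega> (L \<union> R - {v})) =
      of_bool ({#\<omega> q, \<omega> v#} = Q)" if "v \<in> R" for v
  proof -
    have "R \<inter> {v} = {v}" "L \<inter> {v} = {}" using that T' by auto
    moreover have "\<omega> q > 0" "\<omega> v > 0" using that T' pos by auto
    ultimately show ?thesis
      using Wv[of v] that by (subst merged_pair_iff[where P = "{#\<omega> q, \<omega> v#}"]) auto
  qed
  have J: "?G ({#\<omega> p + \<omega> q#} + vertex_weights \<omega> (L \<union> R)) = of_bool ({#\<omega> p, \<omega> q#} = Q)"
  proof -
    have "\<omega> p > 0" "\<omega> q > 0" using T' pos by auto
    then show ?thesis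
      using W by (subst merged_pair_iff[where P = "{#\<omega> p, \<omega> q#}"]) auto
  qed
  have "(\<Sum>A\<in>Pow E. if size (component_weights V \<omega> A) = card (L \<union> R) + 2 - 1
       then ?G (component_weights V \<omega> A) else 0) =
    (\<Sum>v\<in>L \<union> R. ?G ({#\<omega> p + sum \<omega> (L \<inter> {v}), \<omega> q + sum \<omega> (R \<inter> {v})#} + vertex_weights \<omega> (L \<union> R - {v}))) +
    ?G ({#\<omega> p + \<omega> q#} + vertex_weights \<omega> (L \<union> R))"
    using T' subsets_card_0[of "L \<union> R"]
    by (subst sum_of_size[OF T]) (simp_all only: sum_subsets_card_1 vertex_weights_def, simp)
  also have "\<dots> = (\<Sum>v\<in>L. of_bool ({#\<omega> p, \<omega> v#} = Q)) + (\<Sum>v\<in>R. of_bool ({#\<omega> q, \<omega> v#} = Q)) +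
      of_bool ({#\<omega> p, \<omega> q#} = Q)"
  proof -
    have "(\<Sum>v\<in>L \<union> R. g v) = (\<Sum>v\<in>L. g v) + (\<Sum>v\<in>R. g v)" for g :: "'a \<Rightarrow> int"
      using T' by (intro sum.union_disjoint) auto
    then show ?thesis
      by (simp only: J L R cong: sum.cong)
  qed
  finally show ?thesis
    using T' by (simp add: edge_types_def count_image_mset_set)
qed

lemma sum_component_weights_cong:
  fixes F :: "nat multiset \<Rightarrow> int"
  assumes "image_mset (component_weights V \<omega>) (mset_set (Pow E)) =
    image_mset (component_weights V' \<omega>') (mset_set (Pow E'))"
  shows "(\<Sum>A\<in>Pow E. F (component_weights V \<omega> A)) = (\<Sum>A\<in>Pow E'. F (component_weights V' \<omega>' A))"
  using arg_cong[OF assms, of "\<lambda>X. sum_mset (image_mset F X)"]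
  by (simp add: sum_unfold_sum_mset image_mset.compositionality o_def)

lemma two_star_invariants:
  assumes T: "two_star_at V E p q L R" and T': "two_star_at V' E' p' q' L' R'"
    and pos: "\<forall>v\<in>V. \<omega> v > 0" and pos': "\<forall>v\<in>V'. \<omega>' v > 0"
    and H: "image_mset (component_weights V \<omega>) (mset_set (Pow E)) =
      image_mset (component_weights V' \<omega>') (mset_set (Pow E'))"
  shows card_leaves_eq: "card (L \<union> R) = card (L' \<union> R')"
    and vertex_weights_eq: "vertex_weights \<omega> V = vertex_weights \<omega>' V'"
    and edge_types_eq: "edge_types \<omega> p q L R = edge_types \<omega>' p' q' L' R'"
proof -
  have fin: "finite (L \<union> R)" "finite (L' \<union> R')"
    using T T' by (auto simp: two_star_at_def)
  have "2 * 2 ^ card (L \<union> R) = (2 * 2 ^ card (L' \<union> R') :: int)"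
    using sum_component_weights_cong[OF H, of "\<lambda>_. 1"] fin
      sum_over_edge_subsets[OF T, of "\<lambda>_. 1"] sum_over_edge_subsets[OF T', of "\<lambda>_. 1"]
    by (simp add: card_Pow)
  then show card: "card (L \<union> R) = card (L' \<union> R')"
    by simp
  \<comment> \<open>Only the empty edge set has this many components, and its component weights are
    the vertex weights.\<close>
  let ?F = "\<lambda>M. if size M = card (L \<union> R) + 2 - 0 then of_bool (M = vertex_weights \<omega> V) else (0::int)"
  have W: "{#\<omega> p, \<omega> q#} + image_mset \<omega> (mset_set (L \<union> R)) = vertex_weights \<omega> V"
    using vertex_weights_two_star[OF T] T vertex_weights_Un[of L R \<omega>]
    by (simp add: two_star_at_def vertex_weights_def)
  have W': "{#\<omega>' p', \<omega>' q'#} + image_mset \<omega>' (mset_set (L' \<union> R')) = vertex_weights \<omega>' V'"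
    using vertex_weights_two_star[OF T'] T' vertex_weights_Un[of L' R' \<omega>']
    by (simp add: two_star_at_def vertex_weights_def)
  have "(\<Sum>A\<in>Pow E. ?F (component_weights V \<omega> A)) = 1"
    using W subsets_card_0[OF fin(1)] by (subst sum_of_size[OF T]) simp_all
  moreover have "(\<Sum>A\<in>Pow E'. ?F (component_weights V' \<omega>' A)) =
      of_bool (vertex_weights \<omega>' V' = vertex_weights \<omega> V)"
    using W' subsets_card_0[OF fin(2)] unfolding card by (subst sum_of_size[OF T']) simp_all
  ultimately show W_eq: "vertex_weights \<omega> V = vertex_weights \<omega>' V'"
    using sum_component_weights_cong[OF H, of ?F] by (simp split: if_splits)
  have "int (count (edge_types \<omega> p q L R) Q) = int (count (edge_types \<omega>' p' q' L' R') Q)" for Q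
    unfolding count_edge_types[OF T pos] count_edge_types[OF T' pos'] card W_eq
    by (rule sum_component_weights_cong[OF H])
  then show "edge_types \<omega> p q L R = edge_types \<omega>' p' q' L' R'"
    by (intro multiset_eqI) simp
qed

section \<open>Centers of different weights\<close>

lemma count_image_pair:
  "count (image_mset (\<lambda>x. {#a, x#}) M) {#a, w#} = count M w"
  for a w :: "'a"
  by (induction M) auto

lemma edge_types_weights:
  "edge_types \<omega> p q L R = add_mset {#\<omega> p, \<omega> q#}
     (image_mset (\<lambda>x. {#\<omega> p, x#}) (vertex_weights \<omega> L) + image_mset (\<lambda>x. {#\<omega> q, x#}) (vertex_weights \<omega> R))"
  by (simp add: edge_types_def vertex_weights_def image_mset.compositionality o_def)

text \<open>An edge between a center of weight \<open>a\<close> and a leaf of weight \<open>w\<close> betrays its center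
  unless \<open>w = b\<close>; the leaves of weight \<open>b\<close> at the \<open>a\<close>-center are counted by complement.\<close>

lemma leaf_weights_of_edge_types:
  fixes M N M' N' :: "'a multiset"
  assumes "a \<noteq> b" "M + N = M' + N'"
    and eq: "image_mset (\<lambda>x. {#a, x#}) M + image_mset (\<lambda>x. {#b, x#}) N =
      image_mset (\<lambda>x. {#a, x#}) M' + image_mset (\<lambda>x. {#b, x#}) N'"
  shows "M = M' \<and> N = N'"
proof -
  have zero: "count (image_mset (\<lambda>x. {#c, x#}) K) {#d, w#} = 0" if "c \<noteq> d" "w \<noteq> c" for c d w :: 'a and K
    using that by (auto simp: count_eq_zero_iff add_eq_conv_ex)
  have M: "count M w = count M' w" if "w \<noteq> b" for w
    using arg_cong[OF eq, of "\<lambda>X. count X {#a, w#}"] zero[of b a w] that assms(1)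
    by (simp add: count_image_pair)
  have "count N b = count N' b"
    using arg_cong[OF eq, of "\<lambda>X. count X {#b, b#}"] zero[of a b b] assms(1)
    by (simp add: count_image_pair)
  then have "count M b = count M' b"
    using arg_cong[OF assms(2), of "\<lambda>X. count X b"] by simp
  with M have "M = M'" by (intro multiset_eqI) metis
  then show ?thesis using assms(2) by simp
qed

lemma weight_isomorphic_distinct_centers:
  assumes T: "two_star_at V E p q L R" and T': "two_star_at V' E' p' q' L' R'"
    and pos: "\<forall>v\<in>V. \<omega> v > 0" and pos': "\<forall>v\<in>V'. \<omega>' v > 0"
    and H: "image_mset (component_weights V \<omega>) (mset_set (Pow E)) =
      image_mset (component_weights V' \<omega>') (mset_set (Pow E'))"
    and centers: "\<omega> p = \<omega>' p'" "\<omega> q = \<omega>' q'" "\<omega> p \<noteq> \<omega> q"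
  shows "weight_isomorphic V E \<omega> V' E' \<omega>'"
proof -
  note inv = two_star_invariants[OF T T' pos pos' H]
  have "vertex_weights \<omega> L + vertex_weights \<omega> R = vertex_weights \<omega>' L' + vertex_weights \<omega>' R'"
    using inv(2) centers unfolding vertex_weights_two_star[OF T] vertex_weights_two_star[OF T'] by simp
  moreover have "image_mset (\<lambda>x. {#\<omega> p, x#}) (vertex_weights \<omega> L) + image_mset (\<lambda>x. {#\<omega> q, x#}) (vertex_weights \<omega> R) =
    image_mset (\<lambda>x. {#\<omega> p, x#}) (vertex_weights \<omega>' L') + image_mset (\<lambda>x. {#\<omega> q, x#}) (vertex_weights \<omega>' R')"
    using inv(3) centers by (simp add: edge_types_weights)
  ultimately show ?thesis
    using leaf_weights_of_edge_types[OF centers(3)] weight_isomorphic_of_leaf_weights[OF T T' centers(1,2)]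
    unfolding vertex_weights_def by blast
qed

section \<open>Centers of equal weights\<close>

text \<open>Vertices are grouped by weight. \<open>I\<close> may exceed the set of weights, so two
  trees can share it.\<close>

lemma sum_vertices_eq_sum_count:
  fixes h :: "nat \<Rightarrow> int"
  assumes "finite A" "finite I" "\<omega> ` A \<subseteq> I"
  shows "(\<Sum>v\<in>A. h (\<omega> v)) = (\<Sum>w\<in>I. int (count (vertex_weights \<omega> A) w) * h w)"
proof -
  have "(\<Sum>w\<in>I. int (count (vertex_weights \<omega> A) w) * h w) = (\<Sum>w\<in>I. \<Sum>v\<in>A. of_bool (\<omega> v = w) * h w)"
    using assms(1) by (simp add: vertex_weights_def count_image_mset_set sum_distrib_right)
  also have "\<dots> = (\<Sum>v\<in>A. \<Sum>w\<in>I. of_bool (\<omega> v = w) * h w)"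
    by (rule sum.swap)
  also have "\<dots> = (\<Sum>v\<in>A. h (\<omega> v))"
  proof (rule sum.cong[OF refl])
    fix v assume "v \<in> A"
    then have "(\<Sum>w\<in>I. of_bool (\<omega> v = w) * h w) = (\<Sum>w\<in>{\<omega> v}. h w)"
      using assms by (intro sum.mono_neutral_cong_right) auto
    then show "(\<Sum>w\<in>I. of_bool (\<omega> v = w) * h w) = h (\<omega> v)" by simp
  qed
  finally show ?thesis by simp
qed

text \<open>Squares agree, so a nonzero value of \<open>d\<close> agrees with that of
  \<open>e\<close> up to sign; cancelling it spreads this sign to all arguments.\<close>

lemma sign_determined_by_products:
  fixes d e :: "'i \<Rightarrow> int"
  assumes "\<And>x y. d x * d y = e x * e y"
  shows "d = e \<or> d = (\<lambda>x. - e x)"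
proof (cases "\<exists>x. d x \<noteq> 0")
  case True
  then obtain x where x: "d x \<noteq> 0" by blast
  have "d x = e x \<or> d x = - e x"
    using assms[of x x] square_eq_iff by blast
  then show ?thesis
  proof
    assume "d x = e x"
    then have "d y = e y" for y
      using assms[of x y] x by (metis mult_cancel_left)
    then show ?thesis by auto
  next
    assume "d x = - e x"
    then have "d x * d y = d x * - e y" for y
      using assms[of x y] by simp
    then have "d y = - e y" for y
      using x by (simp only: mult_cancel_left) blast
    then show ?thesis by auto
  qed
next
  case False
  then have "d y = e y" for y
    using assms[of y y] by auto
  then show ?thesis by auto
qed

text \<open>Two leaves of weights \<open>i\<close>, \<open>j\<close> at different centers of weight \<open>a\<close> can produce the same component
  weights as two leaves of weights \<open>x\<close>, \<open>y\<close> at the same center only if \<open>x + y < i + j\<close>.\<close>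

lemma cross_coincidence_bound:
  fixes a i j x y :: nat
  assumes "{#a + i, a + j, x, y#} = {#a, a + x + y, i, j#}" "a > 0" "i > 0" "j > 0"
  shows "x + y < i + j"
proof -
  have "a + x + y \<in># {#a + i, a + j, x, y#}"
    unfolding assms(1) by simp
  then show ?thesis using assms(2-) by auto
qed

text \<open>Take a pair with differing products and \<open>x + y\<close> maximal. In the identity
  for this pair, a cross coincidence needs \<open>i + j > x + y\<close>, where the products already
  agree; only a nonzero multiple of the difference at \<open>(x, y)\<close> remains.\<close>

lemma products_determined:
  fixes d e :: "nat \<Rightarrow> int" and a :: nat
  assumes "a > 0" "finite I" "\<And>i. i \<in> I \<Longrightarrow> i > 0"
    and d: "\<And>i. i \<notin> I \<Longrightarrow> d i = 0" and e: "\<And>i. i \<notin> I \<Longrightarrow> e i = 0"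
    and \<Phi>: "\<And>x y i j. \<Phi> x y i j = of_bool ({#i, j#} = {#x, y#}) -
      (of_bool ({#a + i, a + j, x, y#} = {#a, a + x + y, i, j#}) :: int)"
    and eq: "\<And>x y. (\<Sum>i\<in>I. \<Sum>j\<in>I. d i * d j * \<Phi> x y i j) = (\<Sum>i\<in>I. \<Sum>j\<in>I. e i * e j * \<Phi> x y i j)"
  shows "d x * d y = e x * e y"
proof -
  define D where "D = (\<lambda>(i, j). d i * d j - e i * e j)"
  let ?B = "{z \<in> I \<times> I. D z \<noteq> 0}"
  have "?B = {}"
  proof (rule ccontr)
    assume "?B \<noteq> {}"
    moreover have "finite ?B" using assms(2) by simp
    ultimately have "Max ((\<lambda>z. fst z + snd z) ` ?B) \<in> (\<lambda>z. fst z + snd z) ` ?B"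
      by (intro Max_in) (simp_all only: finite_imageI image_is_empty not_False_eq_True)
    then obtain z where z: "z \<in> ?B" "fst z + snd z = Max ((\<lambda>z. fst z + snd z) ` ?B)"
      by (metis (no_types, lifting) imageE)
    obtain x y where z_eq: "z = (x, y)" by (cases z)
    have xy: "(x, y) \<in> ?B"
      using z(1) z_eq by simp
    have max: "i + j \<le> x + y" if "(i, j) \<in> ?B" for i j
      using Max_ge[OF finite_imageI[OF \<open>finite ?B\<close>] imageI[OF that], of "\<lambda>z. fst z + snd z"] z(2) z_eq
      by simp
    have "0 = (\<Sum>(i, j)\<in>I \<times> I. D (i, j) * \<Phi> x y i j)"
      using eq[of x y] by (simp add: D_def left_diff_distrib case_prod_beta sum_subtractf sum.cartesian_product)
    also have "\<dots> = (\<Sum>(i, j)\<in>I \<times> I. D (x, y) * of_bool ({#i, j#} = {#x, y#}))"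
    proof (intro sum.cong refl, clarify)
      fix i j assume ij: "i \<in> I" "j \<in> I"
      have sym: "D (i, j) = D (x, y)" if "{#i, j#} = {#x, y#}"
        using that by (auto simp: add_eq_conv_ex D_def mult.commute)
      show "D (i, j) * \<Phi> x y i j = D (x, y) * of_bool ({#i, j#} = {#x, y#})"
      proof (cases "D (i, j) = 0")
        case True
        then show ?thesis using sym by auto
      next
        case False
        then have "{#a + i, a + j, x, y#} \<noteq> {#a, a + x + y, i, j#}"
          using max[of i j] cross_coincidence_bound[of a i j x y] ij assms(1,3) by fastforce
        then show ?thesis using sym by (simp add: \<Phi>)
      qed
    qed
    also have "\<dots> = D (x, y) * (\<Sum>(i, j)\<in>I \<times> I. of_bool ({#i, j#} = {#x, y#}))"
      by (simp add: sum_distrib_left case_prod_beta)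
    finally have "(\<Sum>(i, j)\<in>I \<times> I. of_bool ({#i, j#} = {#x, y#})) = (0::int)"
      using xy by simp
    \<comment> \<open>The term at \<open>(x, y)\<close> itself makes the sum positive.\<close>
    moreover have "(\<Sum>(i, j)\<in>I \<times> I. of_bool ({#i, j#} = {#x, y#})) \<ge> (\<Sum>(i, j)\<in>{(x, y)}. of_bool ({#i, j#} = {#x, y#}) :: int)"
      using xy assms(2) by (intro sum_mono2) auto
    ultimately show False by simp
  qed
  then show ?thesis
    using d[of x] d[of y] e[of x] e[of y] by (cases "x \<in> I \<and> y \<in> I") (auto simp: D_def)
qed

section \<open>Signed sums over the leaves\<close>

definition leaf_sign :: "'a set \<Rightarrow> 'a \<Rightarrow> int" where
  "leaf_sign L v = (if v \<in> L then 1 else - 1)"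

text \<open>The function \<open>\<delta>\<close> of the outline; exchanging the centers reverses its
  sign.\<close>

definition sign_defect :: "('a \<Rightarrow> nat) \<Rightarrow> 'a set \<Rightarrow> 'a set \<Rightarrow> nat \<Rightarrow> int" where
  "sign_defect \<omega> L R w = int (count (vertex_weights \<omega> L) w) - int (count (vertex_weights \<omega> R) w)"

lemma sum_leaf_sign:
  fixes h :: "nat \<Rightarrow> int"
  assumes "finite L" "finite R" "L \<inter> R = {}" "finite I" "\<omega> ` (L \<union> R) \<subseteq> I"
  shows "(\<Sum>v\<in>L \<union> R. leaf_sign L v * h (\<omega> v)) = (\<Sum>w\<in>I. sign_defect \<omega> L R w * h w)"
proof -
  have "(\<Sum>v\<in>L \<union> R. leaf_sign L v * h (\<omega> v)) =
      (\<Sum>v\<in>L. leaf_sign L v * h (\<omega> v)) + (\<Sum>v\<in>R. leaf_sign L v * h (\<omega> v))"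
    using assms by (intro sum.union_disjoint) auto
  also have "(\<Sum>v\<in>L. leaf_sign L v * h (\<omega> v)) = (\<Sum>v\<in>L. h (\<omega> v))"
    by (intro sum.cong) (auto simp: leaf_sign_def)
  also have "(\<Sum>v\<in>R. leaf_sign L v * h (\<omega> v)) = - (\<Sum>v\<in>R. h (\<omega> v))"
    unfolding sum_negf[symmetric] using assms by (intro sum.cong) (auto simp: leaf_sign_def)
  also have "(\<Sum>v\<in>L. h (\<omega> v)) = (\<Sum>w\<in>I. int (count (vertex_weights \<omega> L) w) * h w)"
    using assms by (intro sum_vertices_eq_sum_count) auto
  also have "(\<Sum>v\<in>R. h (\<omega> v)) = (\<Sum>w\<in>I. int (count (vertex_weights \<omega> R) w) * h w)"
    using assms by (intro sum_vertices_eq_sum_count) auto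
  finally show ?thesis
    by (simp add: sign_defect_def left_diff_distrib sum_subtractf)
qed

lemma sum_leaf_sign_pairs:
  fixes \<Phi> :: "nat \<Rightarrow> nat \<Rightarrow> int"
  assumes "finite L" "finite R" "L \<inter> R = {}" "finite I" "\<omega> ` (L \<union> R) \<subseteq> I"
  shows "(\<Sum>u\<in>L \<union> R. \<Sum>v\<in>L \<union> R. leaf_sign L u * leaf_sign L v * \<Phi> (\<omega> u) (\<omega> v)) =
    (\<Sum>i\<in>I. \<Sum>j\<in>I. sign_defect \<omega> L R i * sign_defect \<omega> L R j * \<Phi> i j)"
proof -
  have "(\<Sum>u\<in>L \<union> R. \<Sum>v\<in>L \<union> R. leaf_sign L u * leaf_sign L v * \<Phi> (\<omega> u) (\<omega> v)) =
      (\<Sum>u\<in>L \<union> R. leaf_sign L u * (\<Sum>v\<in>L \<union> R. leaf_sign L v * \<Phi> (\<omega> u) (\<omega> v)))"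
    by (simp add: sum_distrib_left mult.assoc)
  also have "\<dots> = (\<Sum>u\<in>L \<union> R. leaf_sign L u * (\<Sum>j\<in>I. sign_defect \<omega> L R j * \<Phi> (\<omega> u) j))"
    by (simp only: sum_leaf_sign[OF assms])
  also have "\<dots> = (\<Sum>i\<in>I. sign_defect \<omega> L R i * (\<Sum>j\<in>I. sign_defect \<omega> L R j * \<Phi> i j))"
    by (rule sum_leaf_sign[OF assms])
  finally show ?thesis
    by (simp add: sum_distrib_left mult.assoc)
qed

text \<open>The test asks whether merging \<open>a\<close>, \<open>x\<close>, \<open>y\<close> in
  the vertex weights gives the component weights. \<open>K\<close> is its value for two leaves at
  one center, \<open>\<Gamma>\<close> for leaves at different centers, \<open>\<kappa>\<close> for
  the center edge with one leaf edge. The product of the signs selects between \<open>K\<close> and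
  \<open>\<Gamma>\<close> at the cost of a factor 2; ordered pairs cost another. All but the signed
  sum depends only on the leaf weights.\<close>

lemma sum_two_edge_cuts:
  fixes a x y :: nat
  assumes T: "two_star_at V E p q L R" and p: "\<omega> p = a" and q: "\<omega> q = a" and a: "a > 0"
  defines "K \<equiv> \<lambda>i j. of_bool ({#i, j#} = {#x, y#}) :: int"
    and "\<Gamma> \<equiv> \<lambda>i j. of_bool ({#a + i, a + j, x, y#} = {#a, a + x + y, i, j#}) :: int"
    and "\<kappa> \<equiv> \<lambda>i. of_bool ({#a + a + i, x, y#} = {#a, a + x + y, i#}) :: int"
  shows "4 * (\<Sum>A\<in>Pow E. if size (component_weights V \<omega> A) = card (L \<union> R) + 2 - 2
       then of_bool (component_weights V \<omega> A + {#x, y, a#} = add_mset (a + x + y) (vertex_weights \<omega> V))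
       else 0) =
    (\<Sum>u\<in>L \<union> R. \<Sum>v\<in>L \<union> R. leaf_sign L u * leaf_sign L v * (K (\<omega> u) (\<omega> v) - \<Gamma> (\<omega> u) (\<omega> v))) +
    ((\<Sum>u\<in>L \<union> R. \<Sum>v\<in>L \<union> R. K (\<omega> u) (\<omega> v) + \<Gamma> (\<omega> u) (\<omega> v)) +
     (\<Sum>v\<in>L \<union> R. 4 * \<kappa> (\<omega> v) - 2 * K (\<omega> v) (\<omega> v)))"
    (is "4 * ?lhs = ?signed + _")
proof -
  note T' = T[unfolded two_star_at_def]
  let ?\<Lambda> = "L \<union> R"
  have fin: "finite ?\<Lambda>" using T' by simp
  have W: "vertex_weights \<omega> V = {#a, a#} + vertex_weights \<omega> ?\<Lambda>"
    using vertex_weights_two_star[OF T] T' p q by (simp add: vertex_weights_Un)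
  let ?G = "\<lambda>M. of_bool (M + {#x, y, a#} = add_mset (a + x + y) (vertex_weights \<omega> V)) :: int"
  let ?cut = "\<lambda>S. {#\<omega> p + sum \<omega> (L \<inter> S), \<omega> q + sum \<omega> (R \<inter> S)#} + vertex_weights \<omega> (?\<Lambda> - S)"
  let ?join = "\<lambda>S. {#\<omega> p + \<omega> q + sum \<omega> S#} + vertex_weights \<omega> (?\<Lambda> - S)"
  let ?H = "\<lambda>u v. (K (\<omega> u) (\<omega> v) + \<Gamma> (\<omega> u) (\<omega> v)) +
      leaf_sign L u * leaf_sign L v * (K (\<omega> u) (\<omega> v) - \<Gamma> (\<omega> u) (\<omega> v))"
  have cut: "2 * ?G (?cut {u, v}) = ?H u v" if "u \<in> ?\<Lambda>" "v \<in> ?\<Lambda>" "u \<noteq> v" for u v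
  proof -
    define X where "X = vertex_weights \<omega> (?\<Lambda> - {u, v})"
    have "?\<Lambda> - {u} - {v} = ?\<Lambda> - {u, v}" by auto
    then have W_uv: "vertex_weights \<omega> V = {#a, a, \<omega> u, \<omega> v#} + X"
      using W vertex_weights_remove[OF fin that(1), of \<omega>] vertex_weights_remove[of "?\<Lambda> - {u}" v \<omega>] fin that
      by (simp add: X_def)
    show ?thesis
    proof (cases "u \<in> L \<longleftrightarrow> v \<in> L")
      case True
      have "?cut {u, v} = {#a + \<omega> u + \<omega> v, a#} + X"
      proof (cases "u \<in> L")
        case uL: True
        then have "L \<inter> {u, v} = {u, v}" "R \<inter> {u, v} = {}" using True T' by auto
        then show ?thesis using p q that(3) by (simp add: X_def add.assoc)
      next
        case uL: False
        then have "R \<inter> {u, v} = {u, v}" "L \<inter> {u, v} = {}" using True T' that by auto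
        then show ?thesis using p q that(3) by (simp add: X_def add.assoc)
      qed
      then have "?G (?cut {u, v}) = of_bool ({#a + \<omega> u + \<omega> v, x, y#} = {#a + x + y, \<omega> u, \<omega> v#})"
        by (simp add: W_uv add_mset_commute)
      \<comment> \<open>Since \<open>a > 0\<close>, the entry
        \<open>a + \<omega> u + \<omega> v\<close> exceeds both leaf weights and so must equal
        \<open>a + x + y\<close>.\<close>
      also have "\<dots> = K (\<omega> u) (\<omega> v)"
        using a by (auto simp: K_def add_eq_conv_ex)
      finally show ?thesis using True by (simp add: leaf_sign_def)
    next
      case False
      have "?cut {u, v} = {#a + \<omega> u, a + \<omega> v#} + X"
      proof (cases "u \<in> L")
        case uL: True
        then have "L \<inter> {u, v} = {u}" "R \<inter> {u, v} = {v}" using False T' that by auto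
        then show ?thesis using p q by (simp add: X_def)
      next
        case uL: False
        then have "L \<inter> {u, v} = {v}" "R \<inter> {u, v} = {u}" using False T' that by auto
        then show ?thesis using p q by (simp add: X_def)
      qed
      then have "?G (?cut {u, v}) = \<Gamma> (\<omega> u) (\<omega> v)"
        by (simp add: W_uv \<Gamma>_def add_mset_commute)
      then show ?thesis using False by (auto simp: leaf_sign_def)
    qed
  qed
  have join: "?G (?join {v}) = \<kappa> (\<omega> v)" if "v \<in> ?\<Lambda>" for v
    using W vertex_weights_remove[OF fin that, of \<omega>] p q by (simp add: \<kappa>_def add_mset_commute)
  \<comment> \<open>On the diagonal \<open>\<Gamma>\<close> cancels; this value is subtracted once
    the sum is extended to all pairs.\<close>
  have diag: "?H v v = 2 * K (\<omega> v) (\<omega> v)" for v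
    by (simp add: leaf_sign_def)
  have "?lhs = (\<Sum>S | S \<subseteq> ?\<Lambda> \<and> card S = 2. ?G (?cut S)) + (\<Sum>S | S \<subseteq> ?\<Lambda> \<and> card S + 1 = 2. ?G (?join S))"
    unfolding vertex_weights_def[of \<omega> "?\<Lambda> - _"] by (rule sum_of_size[OF T order_refl])
  also have "(\<Sum>S | S \<subseteq> ?\<Lambda> \<and> card S + 1 = 2. ?G (?join S)) = (\<Sum>v\<in>?\<Lambda>. ?G (?join {v}))"
    using sum_subsets_card_1[where A = ?\<Lambda> and h = "\<lambda>S. ?G (?join S)"] by simp
  also have "\<dots> = (\<Sum>v\<in>?\<Lambda>. \<kappa> (\<omega> v))"
    by (intro sum.cong refl join)
  finally have "4 * ?lhs = 2 * (2 * (\<Sum>S | S \<subseteq> ?\<Lambda> \<and> card S = 2. ?G (?cut S))) + 4 * (\<Sum>v\<in>?\<Lambda>. \<kappa> (\<omega> v))"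
    by simp
  also have "2 * (\<Sum>S | S \<subseteq> ?\<Lambda> \<and> card S = 2. ?G (?cut S)) = (\<Sum>u\<in>?\<Lambda>. \<Sum>v\<in>?\<Lambda> - {u}. ?G (?cut {u, v}))"
    by (rule sum_subsets_card_2[OF fin])
  also have "2 * \<dots> = (\<Sum>u\<in>?\<Lambda>. \<Sum>v\<in>?\<Lambda> - {u}. ?H u v)"
    unfolding sum_distrib_left by (intro sum.cong refl cut) auto
  also have "\<dots> = (\<Sum>u\<in>?\<Lambda>. (\<Sum>v\<in>?\<Lambda>. ?H u v) - 2 * K (\<omega> u) (\<omega> u))"
    using fin by (intro sum.cong refl) (simp only: sum_diff1 if_True diag)
  finally show ?thesis
    by (simp add: sum.distrib sum_subtractf sum_distrib_left)
qed

lemma weight_isomorphic_equal_centers: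
  assumes T: "two_star_at V E p q L R" and T': "two_star_at V' E' p' q' L' R'"
    and pos: "\<forall>v\<in>V. \<omega> v > 0" and pos': "\<forall>v\<in>V'. \<omega>' v > 0"
    and H: "image_mset (component_weights V \<omega>) (mset_set (Pow E)) =
      image_mset (component_weights V' \<omega>') (mset_set (Pow E'))"
    and centers: "\<omega> p = a" "\<omega> q = a" "\<omega>' p' = a" "\<omega>' q' = a"
  shows "weight_isomorphic V E \<omega> V' E' \<omega>'"
proof -
  note TD = T[unfolded two_star_at_def] and TD' = T'[unfolded two_star_at_def]
  note inv = two_star_invariants[OF T T' pos pos' H]
  have a: "a > 0" using pos TD centers by auto
  have weights: "vertex_weights \<omega> L + vertex_weights \<omega> R = vertex_weights \<omega>' L' + vertex_weights \<omega>' R'"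
    using inv(2) centers unfolding vertex_weights_two_star[OF T] vertex_weights_two_star[OF T'] by simp
  then have "image_mset \<omega> (mset_set (L \<union> R)) = image_mset \<omega>' (mset_set (L' \<union> R'))"
    using TD TD' vertex_weights_Un[of L R \<omega>] vertex_weights_Un[of L' R' \<omega>'] by (simp add: vertex_weights_def)
  \<comment> \<open>\<open>h\<close> matches leaves by weight regardless of their centers, which is
    enough to transfer the unsigned sums.\<close>
  then obtain h where h: "bij_betw h (L \<union> R) (L' \<union> R')" "\<And>v. v \<in> L \<union> R \<Longrightarrow> \<omega>' (h v) = \<omega> v"
    using mset_set_image_eq_imp_bij[of "L \<union> R" "L' \<union> R'"] TD TD' by blast
  have transfer: "(\<Sum>v\<in>L' \<union> R'. g (\<omega>' v)) = (\<Sum>v\<in>L \<union> R. g (\<omega> v))" for g :: "nat \<Rightarrow> int"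
  proof -
    have "(\<Sum>v\<in>L' \<union> R'. g (\<omega>' v)) = (\<Sum>v\<in>L \<union> R. g (\<omega>' (h v)))"
      by (rule sum.reindex_bij_betw[OF h(1), symmetric])
    also have "\<dots> = (\<Sum>v\<in>L \<union> R. g (\<omega> v))"
      by (intro sum.cong refl) (simp only: h(2))
    finally show ?thesis .
  qed
  have transfer2: "(\<Sum>u\<in>L' \<union> R'. \<Sum>v\<in>L' \<union> R'. g (\<omega>' u) (\<omega>' v)) =
      (\<Sum>u\<in>L \<union> R. \<Sum>v\<in>L \<union> R. g (\<omega> u) (\<omega> v))" for g :: "nat \<Rightarrow> nat \<Rightarrow> int"
  proof -
    have "(\<Sum>u\<in>L' \<union> R'. \<Sum>v\<in>L' \<union> R'. g (\<omega>' u) (\<omega>' v)) =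
        (\<Sum>u\<in>L' \<union> R'. \<Sum>v\<in>L \<union> R. g (\<omega>' u) (\<omega> v))"
      by (intro sum.cong refl transfer)
    also have "\<dots> = (\<Sum>u\<in>L \<union> R. \<Sum>v\<in>L \<union> R. g (\<omega> u) (\<omega> v))"
      by (rule transfer)
    finally show ?thesis .
  qed
  define I where "I = \<omega> ` (L \<union> R) \<union> \<omega>' ` (L' \<union> R')"
  have I: "finite I" "\<omega> ` (L \<union> R) \<subseteq> I" "\<omega>' ` (L' \<union> R') \<subseteq> I" "\<And>i. i \<in> I \<Longrightarrow> i > 0"
    using TD TD' pos pos' by (auto simp: I_def)
  define \<Phi> where "\<Phi> x y i j = of_bool ({#i, j#} = {#x, y#}) -
      (of_bool ({#a + i, a + j, x, y#} = {#a, a + x + y, i, j#}) :: int)" for x y i j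
  have signed: "(\<Sum>i\<in>I. \<Sum>j\<in>I. sign_defect \<omega> L R i * sign_defect \<omega> L R j * \<Phi> x y i j) =
      (\<Sum>i\<in>I. \<Sum>j\<in>I. sign_defect \<omega>' L' R' i * sign_defect \<omega>' L' R' j * \<Phi> x y i j)" for x y
  proof -
    \<comment> \<open>The totals and the unsigned parts agree for both trees, hence so do the signed
      parts.\<close>
    have "(\<Sum>u\<in>L \<union> R. \<Sum>v\<in>L \<union> R. leaf_sign L u * leaf_sign L v * \<Phi> x y (\<omega> u) (\<omega> v)) =
        (\<Sum>u\<in>L' \<union> R'. \<Sum>v\<in>L' \<union> R'. leaf_sign L' u * leaf_sign L' v * \<Phi> x y (\<omega>' u) (\<omega>' v))"
      using sum_two_edge_cuts[OF T centers(1,2) a, of x y] sum_two_edge_cuts[OF T' centers(3,4) a, of x y]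
        sum_component_weights_cong[OF H, of "\<lambda>M. if size M = card (L \<union> R) + 2 - 2
          then of_bool (M + {#x, y, a#} = add_mset (a + x + y) (vertex_weights \<omega> V)) else 0"]
        transfer2[of "\<lambda>i j. of_bool ({#i, j#} = {#x, y#}) +
          of_bool ({#a + i, a + j, x, y#} = {#a, a + x + y, i, j#})"]
        transfer[of "\<lambda>i. 4 * of_bool ({#a + a + i, x, y#} = {#a, a + x + y, i#}) -
          2 * of_bool ({#i, i#} = {#x, y#})"]
      unfolding inv(1,2) \<Phi>_def by linarith
    then show ?thesis
      using sum_leaf_sign_pairs[of L R I \<omega> "\<Phi> x y"] sum_leaf_sign_pairs[of L' R' I \<omega>' "\<Phi> x y"] TD TD' I
      by simp
  qed
  have off: "sign_defect \<omega> L R i = 0" "sign_defect \<omega>' L' R' i = 0" if "i \<notin> I" for i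
  proof -
    have "i \<notin># vertex_weights \<omega> L" "i \<notin># vertex_weights \<omega> R"
      "i \<notin># vertex_weights \<omega>' L'" "i \<notin># vertex_weights \<omega>' R'"
      using that TD TD' by (auto simp: I_def vertex_weights_def)
    then show "sign_defect \<omega> L R i = 0" "sign_defect \<omega>' L' R' i = 0"
      by (simp_all add: sign_defect_def not_in_iff)
  qed
  have "sign_defect \<omega> L R x * sign_defect \<omega> L R y = sign_defect \<omega>' L' R' x * sign_defect \<omega>' L' R' y" for x y
    by (rule products_determined[OF a I(1) I(4) off \<Phi>_def signed])
  then consider "sign_defect \<omega> L R = sign_defect \<omega>' L' R'"
    | "sign_defect \<omega> L R = (\<lambda>w. - sign_defect \<omega>' L' R' w)"
    using sign_determined_by_products by blast
  then show ?thesis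
  proof cases
    case 1
    have "count (vertex_weights \<omega> L) w = count (vertex_weights \<omega>' L') w \<and>
        count (vertex_weights \<omega> R) w = count (vertex_weights \<omega>' R') w" for w
      using fun_cong[OF 1, of w] arg_cong[OF weights, of "\<lambda>M. count M w"] by (simp add: sign_defect_def)
    then have "vertex_weights \<omega> L = vertex_weights \<omega>' L'" "vertex_weights \<omega> R = vertex_weights \<omega>' R'"
      by (auto intro: multiset_eqI)
    then show ?thesis
      using weight_isomorphic_of_leaf_weights[OF T T'] centers by (simp add: vertex_weights_def)
  next
    case 2
    \<comment> \<open>Opposite differences and equal sums: the leaf sets correspond after exchanging
      the centers of the second tree.\<close>
    have "count (vertex_weights \<omega> L) w = count (vertex_weights \<omega>' R') w \<and>
        count (vertex_weights \<omega> R) w = count (vertex_weights \<omega>' L') w" for w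
      using fun_cong[OF 2, of w] arg_cong[OF weights, of "\<lambda>M. count M w"] by (simp add: sign_defect_def)
    then have "vertex_weights \<omega> L = vertex_weights \<omega>' R'" "vertex_weights \<omega> R = vertex_weights \<omega>' L'"
      by (auto intro: multiset_eqI)
    then show ?thesis
      using weight_isomorphic_of_leaf_weights[OF T two_star_at_swap[OF T']] centers by (simp add: vertex_weights_def)
  qed
qed

section \<open>Matching the centers\<close>

lemma weight_isomorphic_same_centers:
  assumes T: "two_star_at V E p q L R" and T': "two_star_at V' E' p' q' L' R'"
    and pos: "\<forall>v\<in>V. \<omega> v > 0" and pos': "\<forall>v\<in>V'. \<omega>' v > 0"
    and H: "image_mset (component_weights V \<omega>) (mset_set (Pow E)) =
      image_mset (component_weights V' \<omega>') (mset_set (Pow E'))"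
    and centers: "\<omega> p = \<omega>' p'" "\<omega> q = \<omega>' q'"
  shows "weight_isomorphic V E \<omega> V' E' \<omega>'"
proof (cases "\<omega> p = \<omega> q")
  case True
  then show ?thesis
    using weight_isomorphic_equal_centers[OF T T' pos pos' H, of "\<omega> p"] centers by metis
next
  case False
  then show ?thesis
    using weight_isomorphic_distinct_centers[OF T T' pos pos' H centers] by simp
qed

lemma sum_mset_pairs:
  "sum_mset (image_mset (\<lambda>x. {#a, x#}) M) = replicate_mset (size M) a + M"
  by (induction M) auto

text \<open>Each vertex occurs once per incident edge. Beyond one occurrence per vertex, only the
  centers contribute, once for each of their leaves.\<close>

lemma sum_mset_edge_types:
  assumes "two_star_at V E p q L R"
  shows "sum_mset (edge_types \<omega> p q L R) =
    vertex_weights \<omega> V + (replicate_mset (card L) (\<omega> p) + replicate_mset (card R) (\<omega> q))"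
  by (simp add: edge_types_weights sum_mset_pairs vertex_weights_two_star[OF assms])
    (simp add: vertex_weights_def)

lemma star_choose_second_center:
  assumes T: "two_star_at V E p q L {}" and "add_mset (\<omega> p) (add_mset x M) = vertex_weights \<omega> V"
  obtains q' L' where "two_star_at V E p q' L' {}" "\<omega> q' = x"
proof -
  have "add_mset x M = add_mset (\<omega> q) (vertex_weights \<omega> L)"
    using assms(2) unfolding vertex_weights_two_star[OF T] by (simp add: vertex_weights_def)
  then have "x \<in># add_mset (\<omega> q) (vertex_weights \<omega> L)"
    by (metis union_single_eq_member)
  then consider "x = \<omega> q" | v where "v \<in> L" "x = \<omega> v"
    using T by (auto simp: vertex_weights_def two_star_at_def)
  then show ?thesis
    using that T two_star_at_change_center[OF T] by cases auto
qed

text \<open>Some center has leaves, and every such center has weight \<open>c\<close>; an exchange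
  puts one first.\<close>

lemma excess_cases:
  assumes "two_star_at V E p q L R" "set_mset (replicate_mset (card L) (\<omega> p) + replicate_mset (card R) (\<omega> q)) = {c}"
  obtains p q L R where "two_star_at V E p q L R" "\<omega> p = c" "R = {} \<or> \<omega> q = c"
proof -
  note T = assms(1)[unfolded two_star_at_def]
  have *: "(if L = {} then {} else {\<omega> p}) \<union> (if R = {} then {} else {\<omega> q}) = {c}"
    using assms(2) T by (auto simp: set_mset_replicate_mset_subset split: if_splits)
  show ?thesis
  proof (cases "L = {}")
    case True
    then have "\<omega> q = c" using * by (auto split: if_splits)
    then show ?thesis using that[OF two_star_at_swap[OF assms(1)]] True by simp
  next
    case False
    then have "\<omega> p = c" "R = {} \<or> \<omega> q = c" using * by (auto split: if_splits)
    then show ?thesis using that[OF assms(1)] by simp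
  qed
qed

text \<open>Removing the vertex weights from the edge types leaves the excesses \<open>?X\<close>
  and \<open>?X'\<close>, which therefore agree. The cases are the number of distinct weights in
  them.\<close>

lemma two_stars_with_matching_centers:
  assumes T: "two_star_at V E p q L R" and T': "two_star_at V' E' p' q' L' R'"
    and weights: "vertex_weights \<omega> V = vertex_weights \<omega>' V'"
    and types: "edge_types \<omega> p q L R = edge_types \<omega>' p' q' L' R'"
  obtains p q L R p' q' L' R' where "two_star_at V E p q L R" "two_star_at V' E' p' q' L' R'"
    "\<omega> p = \<omega>' p'" "\<omega> q = \<omega>' q'"
proof -
  note result = that
  note TD = T[unfolded two_star_at_def] and TD' = T'[unfolded two_star_at_def]
  let ?X = "replicate_mset (card L) (\<omega> p) + replicate_mset (card R) (\<omega> q)"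
  let ?X' = "replicate_mset (card L') (\<omega>' p') + replicate_mset (card R') (\<omega>' q')"
  have X: "?X = ?X'"
    using arg_cong[OF types, of sum_mset] weights
    unfolding sum_mset_edge_types[OF T] sum_mset_edge_types[OF T'] by simp
  have sets: "set_mset ?X = (if L = {} then {} else {\<omega> p}) \<union> (if R = {} then {} else {\<omega> q})"
    "set_mset ?X' = (if L' = {} then {} else {\<omega>' p'}) \<union> (if R' = {} then {} else {\<omega>' q'})"
    using TD TD' by (auto simp: set_mset_replicate_mset_subset)
  have swap: thesis if eq: "{#\<omega> p, \<omega> q#} = {#\<omega>' p', \<omega>' q'#}"
  proof -
    have "\<omega> p = \<omega>' p' \<and> \<omega> q = \<omega>' q' \<or> \<omega> p = \<omega>' q' \<and> \<omega> q = \<omega>' p'"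
      using eq by (auto simp: add_eq_conv_ex)
    then show thesis
      using result[OF T T'] result[OF T two_star_at_swap[OF T']] by blast
  qed
  consider "set_mset ?X = {}" | c where "set_mset ?X = {c}" | "\<omega> p \<noteq> \<omega> q" "set_mset ?X = {\<omega> p, \<omega> q}"
    unfolding sets(1) by (cases "L = {}"; cases "R = {}"; cases "\<omega> p = \<omega> q") auto
  then show thesis
  proof cases
    case 1
    then have "L = {}" "R = {}" "L' = {}" "R' = {}"
      using sets X by (auto split: if_splits)
    then show thesis
      using weights unfolding vertex_weights_two_star[OF T] vertex_weights_two_star[OF T']
      by (intro swap) (simp add: vertex_weights_def)
  next
    case 3
    then have "set_mset ?X' = {\<omega> p, \<omega> q}" using X by simp
    \<comment> \<open>Two distinct weights can only come from two centers that both have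
      leaves.\<close>
    then have "{\<omega> p, \<omega> q} = {\<omega>' p', \<omega>' q'}"
      using 3(1) unfolding sets(2) by (auto split: if_splits)
    then show thesis
      by (intro swap) (auto simp: doubleton_eq_iff)
  next
    case (2 c)
    obtain p q L R where T: "two_star_at V E p q L R" and pq: "\<omega> p = c" "R = {} \<or> \<omega> q = c"
      using excess_cases[OF T 2] by blast
    obtain p' q' L' R' where T': "two_star_at V' E' p' q' L' R'" and pq': "\<omega>' p' = c" "R' = {} \<or> \<omega>' q' = c"
      using excess_cases[OF T' 2[unfolded X]] by blast
    have W: "vertex_weights \<omega> V = add_mset c (add_mset (\<omega> q) (vertex_weights \<omega> L + vertex_weights \<omega> R))"
      using vertex_weights_two_star[OF T] pq by simp
    have W': "vertex_weights \<omega>' V' = add_mset c (add_mset (\<omega>' q') (vertex_weights \<omega>' L' + vertex_weights \<omega>' R'))"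
      using vertex_weights_two_star[OF T'] pq' by simp
    consider "R = {}" | "R' = {}" | "\<omega> q = c" "\<omega>' q' = c"
      using pq(2) pq'(2) by blast
    then show thesis
    proof cases
      case 1
      \<comment> \<open>The first tree is a star around \<open>p\<close>. By equality of the vertex
        weights it has a further vertex with the weight of \<open>q'\<close>, which becomes the
        second center.\<close>
      then obtain q1 L1 where "two_star_at V E p q1 L1 {}" "\<omega> q1 = \<omega>' q'"
        using star_choose_second_center[of V E p q L \<omega> "\<omega>' q'"] T W' weights pq by metis
      then show thesis using result[OF _ T', of p q1 L1 "{}"] pq pq' by simp
    next
      case 2
      then obtain q1 L1 where "two_star_at V' E' p' q1 L1 {}" "\<omega>' q1 = \<omega> q"
        using star_choose_second_center[of V' E' p' q' L' \<omega>' "\<omega> q"] T' W weights pq' by metis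
      then show thesis using result[OF T, of p' q1 L1 "{}"] pq pq' by simp
    next
      case 3
      then show thesis using result[OF T T'] pq pq' by simp
    qed
  qed
qed

theorem theorem7p18:
  fixes V :: "'a set" and E :: "'a set set" and \<omega> :: "'a \<Rightarrow> nat"
    and V' :: "'b set" and E' :: "'b set set" and \<omega>' :: "'b \<Rightarrow> nat"
  assumes "two_star V E" and "strictly_weighted V \<omega>"
    and "two_star V' E'" and "strictly_weighted V' \<omega>'"
    and "D_poly V E (weight_marking \<omega>) = D_poly V' E' (weight_marking \<omega>')"
  shows "weight_isomorphic V E \<omega> V' E' \<omega>'"
proof -
  obtain p q L R where T: "two_star_at V E p q L R"
    using two_star_imp_two_star_at[OF assms(1)] .
  obtain p' q' L' R' where T': "two_star_at V' E' p' q' L' R'"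
    using two_star_imp_two_star_at[OF assms(3)] .
  have "finite V" "finite E" "finite V'" "finite E'"
    using T T' by (auto simp: two_star_at_def)
  then have H: "image_mset (component_weights V \<omega>) (mset_set (Pow E)) =
      image_mset (component_weights V' \<omega>') (mset_set (Pow E'))"
    using D_poly_determines_component_weights assms(2,4,5) by blast
  have pos: "\<forall>v\<in>V. \<omega> v > 0" "\<forall>v\<in>V'. \<omega>' v > 0"
    using assms(2,4) by (auto simp: strictly_weighted_def)
  note inv = two_star_invariants[OF T T' pos H]
  show ?thesis
    by (rule two_stars_with_matching_centers[OF T T' inv(2,3)])
      (rule weight_isomorphic_same_centers[OF _ _ pos H])
qed

end
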